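(* Let $\nu,\delta>0$, let $\rho\in L^2(\mathbb{T}^d)$, $\rho\ge0$, let $K\subset\mathbb{T}^d$ be finite and let $k$ be a smooth cost of jumps. Let $\mathcal F:H^1(\mathbb{T}^d)\to\mathbb{R}$ be strictly convex and bounded from below, and assume there exists a map $f$ such that for all $m,m'\in H^1(\mathbb{T}^d)$ $$\lim_{\theta\to0}\frac{\mathcal F((1-\theta)m+\theta m')-\mathcal F(m)}{\theta}=\int_{\mathbb{T}^d}f(m)(m'-m),$$ where $f$ is continuous from $H^1(\mathbb{T}^d)$ with its weak topology to $H^{-1}(\mathbb{T}^d)$, is bounded from below by a constant $-C$ ($C>0$) on nonnegative elements of $H^1(\mathbb{T}^d)$, and maps $H^1(\mathbb{T}^d)$ into a bounded subset of $L^d(\mathbb{T}^d)$. Let $(u,m)\in H^2(\mathbb{T}^d)\times H^1(\mathbb{T}^d)$, $m\ge0$, be the solution of the stationary mean field game system $$\begin{cases}\max(-\nu\Delta u+\delta u-f(m),\,u-Mu)=0\ \text{in }\mathbb{T}^d,\\ \forall v\in H^1(\mathbb{T}^d),\ v\le Mv:\quad \nu\int_{\mathbb{T}^d}\nabla m\cdot\nabla(v-u)+\delta\int_{\mathbb{T}^d}m(v-u)\ge\int_{\mathbb{T}^d}\rho(v-u),\\ \int_{\mathbb{T}^d}(-\nu\Delta u+\delta u-f(m))\,m=0.\end{cases}$$ Then $m$ is the unique minimizer of the problem $$\inf_{m'\in\mathcal H}\ \mathcal F(m')-D(m'),\qquad \mathcal H=\{m'\in H^1(\mathbb{T}^d):\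 m'\ge0\}.$$
   Context: $\mathbb{T}^d$ is the $d$-dimensional torus. $k$ is a smooth cost of jumps if $k(\cdot,\xi)\in H^2(\mathbb{T}^d)$ for all $\xi\in K$, $x\mapsto\inf_{\xi\in K}k(x,\xi)$ belongs to $W^{2,\infty}(\mathbb{T}^d)$, and there is $k_0>0$ with $k\ge k_0$. $Mu(x)=\inf_{\xi\in K}\{k(x,\xi)+u(x+\xi)\}$. $D(m):=\inf\{\nu\int_{\mathbb{T}^d}\nabla m\cdot\nabla v+\delta\int_{\mathbb{T}^d}mv-\int_{\mathbb{T}^d}\rho v:\ v\in H^1(\mathbb{T}^d),\ v\le Mv\}$, with values in $\mathbb{R}_-\cup\{-\infty\}$. The first line of the system is understood as the associated quasi-variational inequality: $u\le Mu$ a.e. and for all $v\in H^1(\mathbb{T}^d)$ with $v\le Mu$, $\nu\int\nabla u\cdot\nabla(v-u)+\delta\int u(v-u)\ge\int f(m)(v-u)$. *)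

theory Defs
  imports "HOL-Analysis.Analysis"
begin

text \<open>
  The torus of dimension \<open>d = CARD('n)\<close> is R^d/Z^d. Functions on it are Z^d-periodic functions on
  \<open>real^'n\<close>, its points are represented in the half-open unit cell, and its measure is Lebesgue
  measure on that cell. Elements of the function spaces are represented by Borel functions, so
  equality and order are meant almost everywhere.
\<close>

definition unit_cell :: "(real^'n) set" where
  "unit_cell = {x. \<forall>i. 0 \<le> x $ i \<and> x $ i < 1}"

definition torus :: "(real^'n) measure" where
  "torus = restrict_space lborel unit_cell"

definition periodic :: "(real^'n \<Rightarrow> real) \<Rightarrow> bool" where
  "periodic u \<longleftrightarrow> (\<forall>x i. u (x + axis i 1) = u x)"

definition ae_eq :: "(real^'n \<Rightarrow> real) \<Rightarrow> (real^'n \<Rightarrow> real) \<Rightarrow> bool" where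
  "ae_eq u v \<longleftrightarrow> (AE x in torus. u x = v x)"

definition ae_le :: "(real^'n \<Rightarrow> real) \<Rightarrow> (real^'n \<Rightarrow> real) \<Rightarrow> bool" where
  "ae_le u v \<longleftrightarrow> (AE x in torus. u x \<le> v x)"

definition Lp :: "ennreal \<Rightarrow> (real^'n \<Rightarrow> real) set" where
  "Lp p = {u. periodic u \<and> u \<in> borel_measurable borel \<and>
     (if p = \<infinity> then \<exists>B. AE x in torus. \<bar>u x\<bar> \<le> B
      else integrable torus (\<lambda>x. \<bar>u x\<bar> powr enn2real p))}"

definition Lp_norm :: "ennreal \<Rightarrow> (real^'n \<Rightarrow> real) \<Rightarrow> real" where
  "Lp_norm p u =
     (if p = \<infinity> then Inf {B. 0 \<le> B \<and> (AE x in torus. \<bar>u x\<bar> \<le> B)}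
      else (integral\<^sup>L torus (\<lambda>x. \<bar>u x\<bar> powr enn2real p)) powr (1 / enn2real p))"

definition partial :: "'n \<Rightarrow> (real^'n \<Rightarrow> real) \<Rightarrow> real^'n \<Rightarrow> real" where
  "partial i \<phi> x = frechet_derivative \<phi> (at x) (axis i 1)"

primrec Ck :: "nat \<Rightarrow> (real^'n \<Rightarrow> real) \<Rightarrow> bool" where
  "Ck 0 \<phi> \<longleftrightarrow> continuous_on UNIV \<phi>"
| "Ck (Suc n) \<phi> \<longleftrightarrow> \<phi> differentiable_on UNIV \<and> (\<forall>i. Ck n (partial i \<phi>))"

definition test_function :: "(real^'n \<Rightarrow> real) \<Rightarrow> bool" where
  "test_function \<phi> \<longleftrightarrow> periodic \<phi> \<and> (\<forall>n. Ck n \<phi>)"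

definition weak_partial :: "'n \<Rightarrow> (real^'n \<Rightarrow> real) \<Rightarrow> (real^'n \<Rightarrow> real) \<Rightarrow> bool" where
  "weak_partial i u g \<longleftrightarrow> u \<in> Lp 1 \<and> g \<in> Lp 1 \<and>
     (\<forall>\<phi>. test_function \<phi> \<longrightarrow>
        integral\<^sup>L torus (\<lambda>x. u x * partial i \<phi> x) = - integral\<^sup>L torus (\<lambda>x. g x * \<phi> x))"

text \<open>A representative of the weak derivative, which is unique up to null sets.\<close>

definition wd :: "'n \<Rightarrow> (real^'n \<Rightarrow> real) \<Rightarrow> real^'n \<Rightarrow> real" where
  "wd i u = (SOME g. weak_partial i u g)"

definition laplacian :: "(real^'n \<Rightarrow> real) \<Rightarrow> real^'n \<Rightarrow> real" where
  "laplacian u x = (\<Sum>i\<in>UNIV. wd i (wd i u) x)"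

primrec sobolev :: "nat \<Rightarrow> ennreal \<Rightarrow> (real^'n \<Rightarrow> real) set" where
  "sobolev 0 p = Lp p"
| "sobolev (Suc s) p = {u \<in> Lp p. \<forall>i. \<exists>g \<in> sobolev s p. weak_partial i u g}"

abbreviation H1 :: "(real^'n \<Rightarrow> real) set" where "H1 \<equiv> sobolev 1 2"
abbreviation H2 :: "(real^'n \<Rightarrow> real) set" where "H2 \<equiv> sobolev 2 2"

definition inner_grad :: "(real^'n \<Rightarrow> real) \<Rightarrow> (real^'n \<Rightarrow> real) \<Rightarrow> real" where
  "inner_grad u v = integral\<^sup>L torus (\<lambda>x. \<Sum>i\<in>UNIV. wd i u x * wd i v x)"

definition inner_L2 :: "(real^'n \<Rightarrow> real) \<Rightarrow> (real^'n \<Rightarrow> real) \<Rightarrow> real" where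
  "inner_L2 u v = integral\<^sup>L torus (\<lambda>x. u x * v x)"

definition H1_norm :: "(real^'n \<Rightarrow> real) \<Rightarrow> real" where
  "H1_norm u = sqrt (inner_L2 u u + inner_grad u u)"

text \<open>
  The dual \<open>H\<^sup>-\<^sup>1\<close> of \<open>H1\<close>. A bounded functional takes equal values on functions that agree almost
  everywhere, so it does act on the equivalence classes.
\<close>

definition dual_H1 :: "((real^'n \<Rightarrow> real) \<Rightarrow> real) set" where
  "dual_H1 = {l \<in> extensional H1.
     (\<forall>u\<in>H1. \<forall>v\<in>H1. \<forall>a b. l (\<lambda>x. a * u x + b * v x) = a * l u + b * l v) \<and>
     (\<exists>B. \<forall>u\<in>H1. \<bar>l u\<bar> \<le> B * H1_norm u)}"

text \<open>
  The metric of the dual norm: the least \<open>B\<close> with \<open>\<bar>l u - l' u\<bar> \<le> B * H1_norm u\<close>. The value 0 outside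
  \<open>dual_H1\<close> only serves the locale \<open>Metric_space\<close>, which wants a total nonnegative function.
\<close>

definition dual_dist :: "((real^'n \<Rightarrow> real) \<Rightarrow> real) \<Rightarrow> ((real^'n \<Rightarrow> real) \<Rightarrow> real) \<Rightarrow> real" where
  "dual_dist l l' = (if l \<in> dual_H1 \<and> l' \<in> dual_H1
     then Inf {B. 0 \<le> B \<and> (\<forall>u\<in>H1. \<bar>l u - l' u\<bar> \<le> B * H1_norm u)} else 0)"

definition dual_H1_topology :: "((real^'n \<Rightarrow> real) \<Rightarrow> real) topology" where
  "dual_H1_topology = Metric_space.mtopology dual_H1 dual_dist"

definition weak_H1_topology :: "(real^'n \<Rightarrow> real) topology" where
  "weak_H1_topology =
     topology_generated_by {{u \<in> H1. l u \<in> U} | l U. l \<in> dual_H1 \<and> open U}"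

lemma H1_norm_nonneg: "0 \<le> H1_norm u"
  unfolding H1_norm_def inner_L2_def inner_grad_def
  by (intro real_sqrt_ge_zero add_nonneg_nonneg Bochner_Integration.integral_nonneg sum_nonneg) auto

lemma dual_dist_props:
  fixes l l' :: "(real^'n \<Rightarrow> real) \<Rightarrow> real"
  assumes "l \<in> dual_H1" "l' \<in> dual_H1"
  shows dual_dist_nonneg: "0 \<le> dual_dist l l'"
    and dual_dist_bound: "\<And>u. u \<in> H1 \<Longrightarrow> \<bar>l u - l' u\<bar> \<le> dual_dist l l' * H1_norm u"
proof -
  let ?S = "{B. 0 \<le> B \<and> (\<forall>u\<in>H1. \<bar>l u - l' u\<bar> \<le> B * H1_norm u)}"
  obtain B where B: "\<And>u. u \<in> H1 \<Longrightarrow> \<bar>l u\<bar> \<le> B * H1_norm u"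
    using assms(1) unfolding dual_H1_def by blast
  obtain B' where B': "\<And>u. u \<in> H1 \<Longrightarrow> \<bar>l' u\<bar> \<le> B' * H1_norm u"
    using assms(2) unfolding dual_H1_def by blast
  have "\<bar>l u - l' u\<bar> \<le> (\<bar>B\<bar> + \<bar>B'\<bar>) * H1_norm u" if "u \<in> H1" for u
  proof -
    have "B * H1_norm u \<le> \<bar>B\<bar> * H1_norm u" "B' * H1_norm u \<le> \<bar>B'\<bar> * H1_norm u"
      by (intro mult_right_mono H1_norm_nonneg; simp)+
    then show ?thesis using B[OF that] B'[OF that] by (simp add: distrib_right)
  qed
  then have "\<bar>B\<bar> + \<bar>B'\<bar> \<in> ?S" by fastforce
  then have ne: "?S \<noteq> {}" by blast
  have d: "dual_dist l l' = Inf ?S" using assms by (simp add: dual_dist_def)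
  show "0 \<le> dual_dist l l'" unfolding d using ne by (intro cInf_greatest) auto
  fix u :: "real^'n \<Rightarrow> real" assume u: "u \<in> H1"
  show "\<bar>l u - l' u\<bar> \<le> dual_dist l l' * H1_norm u"
  proof (cases "H1_norm u = 0")
    case True
    then show ?thesis using B[OF u] B'[OF u] by simp
  next
    case False
    then have pos: "0 < H1_norm u" using H1_norm_nonneg[of u] by simp
    have "\<bar>l u - l' u\<bar> / H1_norm u \<le> dual_dist l l'" unfolding d
      using ne u pos by (intro cInf_greatest) (auto simp: pos_divide_le_eq)
    then show ?thesis using pos by (simp add: pos_divide_le_eq)
  qed
qed

lemma dual_dist_le:
  assumes "l \<in> dual_H1" "l' \<in> dual_H1"
    and "0 \<le> B" "\<And>u. u \<in> H1 \<Longrightarrow> \<bar>l u - l' u\<bar> \<le> B * H1_norm u"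
  shows "dual_dist l l' \<le> B"
  using assms by (simp add: dual_dist_def, intro cInf_lower) (auto intro: bdd_belowI)

text \<open>Hence \<open>dual_H1_topology\<close> is the topology of a genuine metric space.\<close>

lemma Metric_space_dual_H1:
  "Metric_space (dual_H1 :: ((real^'n \<Rightarrow> real) \<Rightarrow> real) set) dual_dist"
proof
  fix l l' :: "(real^'n \<Rightarrow> real) \<Rightarrow> real"
  show "0 \<le> dual_dist l l'"
    by (cases "l \<in> dual_H1 \<and> l' \<in> dual_H1") (auto simp: dual_dist_nonneg, auto simp: dual_dist_def)
  show "dual_dist l l' = dual_dist l' l"
    by (simp add: dual_dist_def abs_minus_commute conj_commute)
next
  fix l l' :: "(real^'n \<Rightarrow> real) \<Rightarrow> real"
  assume l: "l \<in> dual_H1" "l' \<in> dual_H1"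
  show "dual_dist l l' = 0 \<longleftrightarrow> l = l'"
  proof
    assume "dual_dist l l' = 0"
    then have "l u = l' u" if "u \<in> H1" for u
      using dual_dist_bound[OF l that] by simp
    moreover have "l \<in> extensional H1" "l' \<in> extensional H1"
      using l unfolding dual_H1_def by auto
    ultimately show "l = l'" by (meson extensionalityI)
  next
    assume "l = l'"
    then have "dual_dist l l' \<le> 0" using l by (intro dual_dist_le) auto
    then show "dual_dist l l' = 0" using dual_dist_nonneg[OF l] by simp
  qed
next
  fix l1 l2 l3 :: "(real^'n \<Rightarrow> real) \<Rightarrow> real"
  assume l: "l1 \<in> dual_H1" "l2 \<in> dual_H1" "l3 \<in> dual_H1"
  show "dual_dist l1 l3 \<le> dual_dist l1 l2 + dual_dist l2 l3"
  proof (rule dual_dist_le[OF l(1,3)])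
    show "0 \<le> dual_dist l1 l2 + dual_dist l2 l3"
      using dual_dist_nonneg[OF l(1,2)] dual_dist_nonneg[OF l(2,3)] by simp
    fix u :: "real^'n \<Rightarrow> real" assume u: "u \<in> H1"
    show "\<bar>l1 u - l3 u\<bar> \<le> (dual_dist l1 l2 + dual_dist l2 l3) * H1_norm u"
      using dual_dist_bound[OF l(1,2) u] dual_dist_bound[OF l(2,3) u] by (simp add: distrib_right)
  qed
qed

text \<open>The element of \<open>H\<^sup>-\<^sup>1\<close> given by a function.\<close>

definition pairing :: "(real^'n \<Rightarrow> real) \<Rightarrow> (real^'n \<Rightarrow> real) \<Rightarrow> real" where
  "pairing g = (\<lambda>\<phi>\<in>H1. inner_L2 g \<phi>)"

definition smooth_cost :: "(real^'n) set \<Rightarrow> (real^'n \<Rightarrow> real^'n \<Rightarrow> real) \<Rightarrow> bool" where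
  "smooth_cost K k \<longleftrightarrow>
     (\<forall>\<xi>\<in>K. (\<lambda>x. k x \<xi>) \<in> H2) \<and>
     (\<lambda>x. INF \<xi>\<in>K. k x \<xi>) \<in> sobolev 2 \<infinity> \<and>
     (\<exists>k0>0. \<forall>\<xi>\<in>K. ae_le (\<lambda>x. k0) (\<lambda>x. k x \<xi>))"

text \<open>The infima of reals here and in \<open>smooth_cost\<close> are only meaningful for nonempty \<open>K\<close>.\<close>

definition jump_op ::
  "(real^'n) set \<Rightarrow> (real^'n \<Rightarrow> real^'n \<Rightarrow> real) \<Rightarrow> (real^'n \<Rightarrow> real) \<Rightarrow> real^'n \<Rightarrow> real" where
  "jump_op K k u x = (INF \<xi>\<in>K. k x \<xi> + u (x + \<xi>))"

definition bilin :: "real \<Rightarrow> real \<Rightarrow> (real^'n \<Rightarrow> real) \<Rightarrow> (real^'n \<Rightarrow> real) \<Rightarrow> real" where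
  "bilin \<nu> \<delta> u v = \<nu> * inner_grad u v + \<delta> * inner_L2 u v"

definition dual_value ::
  "real \<Rightarrow> real \<Rightarrow> (real^'n \<Rightarrow> real) \<Rightarrow> (real^'n) set \<Rightarrow> (real^'n \<Rightarrow> real^'n \<Rightarrow> real) \<Rightarrow>
   (real^'n \<Rightarrow> real) \<Rightarrow> ereal" where
  "dual_value \<nu> \<delta> \<rho> K k m =
     (INF v \<in> {v \<in> H1. ae_le v (jump_op K k v)}. ereal (bilin \<nu> \<delta> m v - inner_L2 \<rho> v))"

definition obstacle_QVI ::
  "real \<Rightarrow> real \<Rightarrow> (real^'n) set \<Rightarrow> (real^'n \<Rightarrow> real^'n \<Rightarrow> real) \<Rightarrow>
   (real^'n \<Rightarrow> real) \<Rightarrow> (real^'n \<Rightarrow> real) \<Rightarrow> bool" where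
  "obstacle_QVI \<nu> \<delta> K k g u \<longleftrightarrow>
     ae_le u (jump_op K k u) \<and>
     (\<forall>v\<in>H1. ae_le v (jump_op K k u) \<longrightarrow>
        bilin \<nu> \<delta> u (\<lambda>x. v x - u x) \<ge> inner_L2 g (\<lambda>x. v x - u x))"

text \<open>
  In the second condition the constraint is \<open>v \<le> M v\<close>, whereas in \<open>obstacle_QVI\<close> it is \<open>v \<le> M u\<close>.
\<close>

definition MFG_solution ::
  "real \<Rightarrow> real \<Rightarrow> (real^'n \<Rightarrow> real) \<Rightarrow> (real^'n) set \<Rightarrow> (real^'n \<Rightarrow> real^'n \<Rightarrow> real) \<Rightarrow>
   ((real^'n \<Rightarrow> real) \<Rightarrow> real^'n \<Rightarrow> real) \<Rightarrow> (real^'n \<Rightarrow> real) \<Rightarrow> (real^'n \<Rightarrow> real) \<Rightarrow> bool" where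
  "MFG_solution \<nu> \<delta> \<rho> K k f u m \<longleftrightarrow>
     u \<in> H2 \<and> m \<in> H1 \<and> ae_le (\<lambda>x. 0) m \<and>
     obstacle_QVI \<nu> \<delta> K k (f m) u \<and>
     (\<forall>v\<in>H1. ae_le v (jump_op K k v) \<longrightarrow>
        bilin \<nu> \<delta> m (\<lambda>x. v x - u x) \<ge> inner_L2 \<rho> (\<lambda>x. v x - u x)) \<and>
     integral\<^sup>L torus (\<lambda>x. (- \<nu> * laplacian u x + \<delta> * u x - f m x) * m x) = 0"

end

theory Submission
  imports Defs
begin

text \<open>
  Testing the quasi-variational inequality with \<open>u - m'\<close> gives \<open>a(u, m') \<le> \<langle>f(m), m'\<rangle>\<close> for every
  \<open>m' \<ge> 0\<close>, where \<open>a\<close> is the bilinear form, and integrating the third equation by parts gives equality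
  for \<open>m' = m\<close>. The second line says that \<open>u\<close> attains the infimum defining \<open>D(m)\<close>, while \<open>u\<close> is only a
  competitor for \<open>D(m')\<close>. So \<open>D(m') - D(m) \<le> a(u, m' - m) \<le> \<langle>f(m), m' - m\<rangle> \<le> \<F>(m') - \<F>(m)\<close>, the last
  step being convexity, which is strict for \<open>m' \<noteq> m\<close>.

  The weak derivatives are only tested against smooth functions. Uniqueness of weak derivatives and
  integration by parts between Sobolev functions come from mollification with the normalized kernels
  \<open>(\<Prod>\<^sub>i (1 + cos (2\<pi> x\<^sub>i)) / 2)\<^sup>n\<close>. These are trigonometric polynomials, so that convolving with
  them yields finite sums of products, hence test functions, without differentiating under an integral.
\<close>

section \<open>Translation invariance of the torus\<close>

text \<open>Mollified functions are nowhere shown to converge in a norm. Only numbers need a limit: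
  the integral of \<open>w\<close> times a mollification of \<open>m\<close>. By Fubini it is a
  kernel average of \<open>corr w m\<close>, so continuity of this one function suffices. It holds
  for integrable \<open>w\<close> with bounded \<open>m\<close> (fundamental lemma, with a sign
  function as \<open>m\<close>) and for two square integrable functions (integration by parts).

  A second obstacle is that Bochner integrals are total: \<open>inner_L2 (f m) m'\<close> is a
  number even if the product is not integrable, and then integrals of sums cannot be split. The
  continuity hypothesis makes \<open>pairing (f m)\<close> a bounded linear functional, and
  integrability against \<open>H1\<close> is extracted from its linearity.

  Finally, \<open>D(m')\<close> may be -\<infinity>. Only \<open>D(m)\<close> is known to be finite,
  because its infimum is attained, and the strict comparison in the extended reals rests on that.
  Strictness comes from the gradient inequality at the midpoint of \<open>m\<close> and
  \<open>m'\<close>, combined with strict convexity there.\<close>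

lemma unit_cell_measurable [measurable]: "unit_cell \<in> sets borel"
proof -
  have "unit_cell = (\<Inter>i. {x::real^'n. 0 \<le> x $ i \<and> x $ i < 1})"
    by (auto simp: unit_cell_def)
  also have "\<dots> \<in> sets borel" by (intro sets.countable_INT'') auto
  finally show ?thesis .
qed

lemma space_torus [simp]: "space torus = unit_cell"
  by (simp add: torus_def space_restrict_space)

lemma sets_torus [measurable_cong]: "sets torus = sets (restrict_space borel unit_cell)"
  by (simp add: torus_def sets_restrict_space)

lemma borel_measurable_torus: "f \<in> measurable borel M \<Longrightarrow> f \<in> measurable torus M"
  by (simp add: torus_def measurable_restrict_space1)

lemma unit_cell_subset: "unit_cell \<subseteq> cbox 0 (1::real^'n)"
  by (auto simp: unit_cell_def mem_box_cart less_imp_le)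

interpretation torus: finite_measure "torus :: (real^'n) measure"
proof
  have "emeasure torus (space (torus::(real^'n) measure)) \<le> emeasure lborel (cbox 0 (1::real^'n))"
    by (simp add: torus_def emeasure_restrict_space space_restrict_space)
      (intro emeasure_mono unit_cell_subset, auto)
  also have "\<dots> < \<infinity>" by (simp add: emeasure_lborel_cbox_eq)
  finally show "emeasure torus (space (torus::(real^'n) measure)) \<noteq> \<infinity>" by auto
qed

lemma nn_integral_torus:
  "(\<integral>\<^sup>+x. f x \<partial>torus) = (\<integral>\<^sup>+x. f x * indicator unit_cell x \<partial>lborel)"
  by (simp add: torus_def nn_integral_restrict_space)

definition lattice :: "(real^'n) set" where
  "lattice = {z. \<forall>i. z $ i \<in> \<int>}"

lemma countable_lattice: "countable (lattice :: (real^'n) set)"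
proof -
  have "lattice \<subseteq> range (\<lambda>g::'n \<Rightarrow> int. (\<chi> i. of_int (g i)) :: real^'n)"
  proof
    fix z :: "real^'n" assume "z \<in> lattice"
    then have "z = (\<chi> i. of_int \<lfloor>z $ i\<rfloor>)"
      by (auto simp: lattice_def vec_eq_iff)
    then show "z \<in> range (\<lambda>g::'n \<Rightarrow> int. (\<chi> i. of_int (g i)) :: real^'n)"
      by (rule range_eqI[where x="\<lambda>i. \<lfloor>z $ i\<rfloor>"])
  qed
  moreover have "countable (UNIV :: ('n \<Rightarrow> int) set)"
    by (rule countableI_type)
  ultimately show ?thesis by (meson countable_image countable_subset)
qed

text \<open>Unit steps along the axes generate the lattice: iterate to natural multiples, invert for
  negative ones, then add up the coordinate directions one at a time.\<close>

lemma periodic_lattice: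
  assumes "periodic u" "z \<in> lattice"
  shows "u (x + z) = u x"
proof -
  have nat: "u (x + real n *\<^sub>R axis i 1) = u x" for x n i
  proof (induction n)
    case (Suc n)
    have "u (x + real (Suc n) *\<^sub>R axis i 1) = u ((x + real n *\<^sub>R axis i 1) + axis i 1)"
      by (simp add: algebra_simps)
    then show ?case using assms(1) Suc by (simp add: periodic_def)
  qed simp
  have int: "u (x + of_int n *\<^sub>R axis i 1) = u x" for x n i
  proof (cases "n \<ge> 0")
    case True
    then show ?thesis using nat[of x "nat n" i] by simp
  next
    case False
    then show ?thesis using nat[of "x + of_int n *\<^sub>R axis i 1" "nat (-n)" i]
      by simp
  qed
  have "u (x + (\<Sum>i\<in>S. (z $ i) *\<^sub>R axis i 1)) = u x" if "finite S" for S
    using that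
  proof induction
    case (insert i S)
    obtain n where n: "z $ i = of_int n" using assms(2) by (auto simp: lattice_def elim: Ints_cases)
    have "u (x + (\<Sum>i\<in>insert i S. (z $ i) *\<^sub>R axis i 1))
        = u ((x + (\<Sum>i\<in>S. (z $ i) *\<^sub>R axis i 1)) + of_int n *\<^sub>R axis i 1)"
      using insert.hyps n by (simp add: algebra_simps)
    then show ?case using int insert.IH by metis
  qed simp
  from this[of UNIV] show ?thesis
    using basis_expansion[of z] by (simp add: scalar_mult_eq_scaleR)
qed

text \<open>The shift is minus the componentwise floor; half-openness of the cell makes it
  unique.\<close>

lemma ex1_lattice_shift: "\<exists>!z. z \<in> lattice \<and> x + z \<in> unit_cell"
proof (rule ex1I)
  show "(\<chi> i. - of_int \<lfloor>x $ i\<rfloor>) \<in> lattice \<and> x + (\<chi> i. - of_int \<lfloor>x $ i\<rfloor>) \<in> unit_cell"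
    by (auto simp: lattice_def unit_cell_def) linarith
  fix z assume z: "z \<in> lattice \<and> x + z \<in> unit_cell"
  have "z $ i = - of_int \<lfloor>x $ i\<rfloor>" for i
  proof -
    obtain n where n: "z $ i = of_int n" using z by (auto simp: lattice_def elim: Ints_cases)
    have "0 \<le> x $ i + of_int n" "x $ i + of_int n < 1" using z n by (auto simp: unit_cell_def) (metis n)+
    then have "\<lfloor>x $ i\<rfloor> = - n" by linarith
    then show ?thesis using n by simp
  qed
  then show "z = (\<chi> i. - of_int \<lfloor>x $ i\<rfloor>)" by (simp add: vec_eq_iff)
qed

lemma lattice_uminus: "z \<in> lattice \<Longrightarrow> - z \<in> lattice"
  by (auto simp: lattice_def)

lemma nn_integral_lborel_shift:
  fixes g :: "'a::euclidean_space \<Rightarrow> ennreal"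
  assumes [measurable]: "g \<in> borel_measurable borel"
  shows "(\<integral>\<^sup>+x. g (x + y) \<partial>lborel) = (\<integral>\<^sup>+x. g x \<partial>lborel)"
proof -
  have "(\<integral>\<^sup>+x. g x \<partial>lborel) = (\<integral>\<^sup>+x. g x \<partial>distr lborel borel ((+) y))"
    by (simp add: lborel_distr_plus)
  also have "\<dots> = (\<integral>\<^sup>+x. g (x + y) \<partial>lborel)"
    by (subst nn_integral_distr) (auto simp: add.commute)
  finally show ?thesis by simp
qed

text \<open>This is \<open>ex1_lattice_shift\<close> as a partition of unity, ready to be inserted
  as a factor under an integral.\<close>

lemma lattice_partition:
  fixes x :: "real^'n"
  shows "(\<integral>\<^sup>+z. indicator unit_cell (x + z) \<partial>count_space lattice) = (1::ennreal)"
proof -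
  obtain z where z: "z \<in> lattice" "x + z \<in> unit_cell" and
    uniq: "\<And>z'. z' \<in> lattice \<Longrightarrow> x + z' \<in> unit_cell \<Longrightarrow> z' = z"
    using ex1_lattice_shift[of x] by auto
  have "(\<integral>\<^sup>+z. indicator unit_cell (x + z) \<partial>count_space lattice)
      = (\<integral>\<^sup>+z'. indicator {z} z' \<partial>count_space lattice)"
  proof (rule nn_integral_cong)
    fix z' assume "z' \<in> space (count_space (lattice :: (real^'n) set))"
    then have "x + z' \<in> unit_cell \<longleftrightarrow> z' \<in> {z}" using z uniq[of z'] by auto
    then show "indicator unit_cell (x + z') = (indicator {z} z' :: ennreal)"
      by (simp only: indicator_def)
  qed
  also have "\<dots> = 1" using z by (simp add: one_ennreal_def[symmetric])
  finally show ?thesis .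
qed

text \<open>Both integrals are split along the translates of the unit cell by lattice points.\<close>

lemma nn_integral_torus_shift:
  fixes g :: "real^'n \<Rightarrow> ennreal"
  assumes [measurable]: "g \<in> borel_measurable borel"
    and per: "\<And>x z. z \<in> lattice \<Longrightarrow> g (x + z) = g x"
  shows "(\<integral>\<^sup>+x. g (x + y) \<partial>torus) = (\<integral>\<^sup>+x. g x \<partial>torus)"
proof -
  have ind [measurable]: "(\<lambda>x. indicator unit_cell (x + a) :: ennreal) \<in> borel_measurable borel" for a :: "real^'n"
    by (rule measurable_compose[of "\<lambda>x. x + a" borel borel]) auto
  have partition: "(\<integral>\<^sup>+x. f x \<partial>lborel)
      = (\<integral>\<^sup>+z. (\<integral>\<^sup>+x. f x * indicator unit_cell (x + (c + z)) \<partial>lborel) \<partial>count_space lattice)"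
    if [measurable]: "f \<in> borel_measurable borel" for f :: "real^'n \<Rightarrow> ennreal" and c
  proof -
    have "(\<integral>\<^sup>+x. f x \<partial>lborel)
       = (\<integral>\<^sup>+x. (\<integral>\<^sup>+z. f x * indicator unit_cell (x + (c + z)) \<partial>count_space lattice) \<partial>lborel)"
      by (simp add: nn_integral_cmult add.assoc[symmetric] lattice_partition)
    also have "\<dots> = (\<integral>\<^sup>+z. (\<integral>\<^sup>+x. f x * indicator unit_cell (x + (c + z)) \<partial>lborel) \<partial>count_space lattice)"
      by (rule nn_integral_count_space_nn_integral) (auto simp: countable_lattice)
    finally show ?thesis .
  qed
  have "(\<integral>\<^sup>+x. g (x + y) \<partial>torus) = (\<integral>\<^sup>+x. g (x + y) * indicator unit_cell x \<partial>lborel)"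
    by (rule nn_integral_torus)
  also have "\<dots> = (\<integral>\<^sup>+z. (\<integral>\<^sup>+x. g (x + y) * indicator unit_cell x * indicator unit_cell (x + (y + z)) \<partial>lborel) \<partial>count_space lattice)"
    by (rule partition) measurable
  \<comment> \<open>In each summand the variable is translated by \<open>y + z\<close>: periodicity
    removes \<open>z\<close> from the argument of \<open>g\<close>, and the two indicators exchange
    roles.\<close>
  also have "\<dots> = (\<integral>\<^sup>+z. (\<integral>\<^sup>+x. g x * indicator unit_cell x * indicator unit_cell (x + (- y + - z)) \<partial>lborel) \<partial>count_space lattice)"
  proof (rule nn_integral_cong)
    fix z :: "real^'n" assume z: "z \<in> space (count_space lattice)"
    have "(\<integral>\<^sup>+x. g x * indicator unit_cell x * indicator unit_cell (x + (- y + - z)) \<partial>lborel)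
      = (\<integral>\<^sup>+x. g (x + (y + z)) * indicator unit_cell (x + (y + z)) * indicator unit_cell ((x + (y + z)) + (- y + - z)) \<partial>lborel)"
      by (rule nn_integral_lborel_shift[symmetric]) measurable
    also have "\<dots> = (\<integral>\<^sup>+x. g (x + y) * indicator unit_cell x * indicator unit_cell (x + (y + z)) \<partial>lborel)"
      using per[of z] z by (intro nn_integral_cong) (simp add: add.assoc[symmetric] mult.commute mult.left_commute)
    finally show "(\<integral>\<^sup>+x. g (x + y) * indicator unit_cell x * indicator unit_cell (x + (y + z)) \<partial>lborel)
      = (\<integral>\<^sup>+x. g x * indicator unit_cell x * indicator unit_cell (x + (- y + - z)) \<partial>lborel)" by simp
  qed
  also have "\<dots> = (\<integral>\<^sup>+z. (\<integral>\<^sup>+x. g x * indicator unit_cell x * indicator unit_cell (x + (- y + z)) \<partial>lborel) \<partial>count_space lattice)"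
  proof (rule nn_integral_bij_count_space[where g=uminus])
    show "bij_betw uminus lattice (lattice :: (real^'n) set)"
      by (rule bij_betwI[where g=uminus]) (auto simp: lattice_uminus)
  qed
  also have "\<dots> = (\<integral>\<^sup>+x. g x * indicator unit_cell x \<partial>lborel)"
    by (rule partition[symmetric]) measurable
  also have "\<dots> = (\<integral>\<^sup>+x. g x \<partial>torus)" by (rule nn_integral_torus[symmetric])
  finally show ?thesis .
qed

lemma torus_shift:
  fixes g :: "real^'n \<Rightarrow> real"
  assumes g [measurable]: "g \<in> borel_measurable borel" and per: "periodic g"
  shows integrable_torus_shift: "integrable torus (\<lambda>x. g (x + y)) \<longleftrightarrow> integrable torus g"
    and integral_torus_shift: "integral\<^sup>L torus (\<lambda>x. g (x + y)) = integral\<^sup>L torus g"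
proof -
  note p = periodic_lattice[OF per]
  have "(\<lambda>x. g (x + y)) \<in> borel_measurable borel" by measurable
  then have m [measurable]: "g \<in> borel_measurable torus" "(\<lambda>x. g (x + y)) \<in> borel_measurable torus"
    using g by (auto intro: borel_measurable_torus)
  show *: "integrable torus (\<lambda>x. g (x + y)) \<longleftrightarrow> integrable torus g"
    using nn_integral_torus_shift[of "\<lambda>x. ennreal (norm (g x))" y]
    by (simp add: integrable_iff_bounded p)
  show "integral\<^sup>L torus (\<lambda>x. g (x + y)) = integral\<^sup>L torus g"
  proof (cases "integrable torus g")
    case True
    then show ?thesis
      using * nn_integral_torus_shift[of "\<lambda>x. ennreal (g x)" y] 
         nn_integral_torus_shift[of "\<lambda>x. ennreal (- g x)" y]
      by (simp add: real_lebesgue_integral_def p)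
  \<comment> \<open>Without integrability both integrals have the default value 0.\<close>
  qed (use * in \<open>simp add: not_integrable_integral_eq\<close>)
qed

section \<open>Test functions\<close>

lemma partial_eqI: "(\<phi> has_derivative D) (at x) \<Longrightarrow> partial i \<phi> x = D (axis i 1)"
  by (metis frechet_derivative_at partial_def)

lemma has_derivative_Ck:
  "Ck (Suc n) \<phi> \<Longrightarrow> (\<phi> has_derivative frechet_derivative \<phi> (at x)) (at x)"
  by (simp add: differentiable_on_def flip: frechet_derivative_works)

lemma Ck_Suc_imp: "Ck (Suc n) \<phi> \<Longrightarrow> Ck n \<phi>"
  by (induction n arbitrary: \<phi>) (auto simp: differentiable_imp_continuous_on)

lemma Ck_const: "Ck n (\<lambda>x. c)"
proof (induction n arbitrary: c)
  case (Suc n)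
  have "partial i (\<lambda>x::real^'a. c) = (\<lambda>x. 0)" for i
    by (rule ext, subst partial_eqI[OF has_derivative_const]) simp
  then show ?case using Suc[of 0] by simp
qed simp

lemma Ck_add: "Ck n \<phi> \<Longrightarrow> Ck n \<psi> \<Longrightarrow> Ck n (\<lambda>x. \<phi> x + \<psi> x)"
proof (induction n arbitrary: \<phi> \<psi>)
  case (Suc n)
  have "partial i (\<lambda>x. \<phi> x + \<psi> x) = (\<lambda>x. partial i \<phi> x + partial i \<psi> x)" for i
    by (rule ext, subst partial_eqI[OF has_derivative_add[OF Suc.prems[THEN has_derivative_Ck]]])
      (simp add: partial_def)
  then show ?case using Suc by (simp add: differentiable_on_add)
qed (simp add: continuous_on_add)

lemma Ck_mult: "Ck n \<phi> \<Longrightarrow> Ck n \<psi> \<Longrightarrow> Ck n (\<lambda>x. \<phi> x * \<psi> x)"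
proof (induction n arbitrary: \<phi> \<psi>)
  case (Suc n)
  have "partial i (\<lambda>x. \<phi> x * \<psi> x) = (\<lambda>x. \<phi> x * partial i \<psi> x + partial i \<phi> x * \<psi> x)" for i
    by (rule ext, subst partial_eqI[OF has_derivative_mult[OF Suc.prems[THEN has_derivative_Ck]]])
      (simp add: partial_def)
  moreover have "Ck n \<phi>" "Ck n \<psi>" using Suc.prems by (auto intro: Ck_Suc_imp)
  ultimately show ?case using Suc by (auto intro!: Ck_add Suc.IH differentiable_on_mult)
qed (simp add: continuous_on_mult)

lemma has_derivative_trig_coordinate:
  fixes x :: "real^'n"
  shows "((\<lambda>x. cos (c * x $ i)) has_derivative (\<lambda>v. - sin (c * x $ i) * (c * v $ i))) (at x)"
    and "((\<lambda>x. sin (c * x $ i)) has_derivative (\<lambda>v. cos (c * x $ i) * (c * v $ i))) (at x)"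
  by (auto intro!: derivative_eq_intros bounded_linear.has_derivative[OF bounded_linear_vec_nth])

text \<open>Stated jointly because differentiation exchanges the two functions up to a constant
  factor, so neither induction closes alone.\<close>

lemma Ck_trig:
  fixes i :: "'n::finite"
  shows "Ck n (\<lambda>x::real^'n. cos (c * x $ i)) \<and> Ck n (\<lambda>x::real^'n. sin (c * x $ i))"
proof (induction n)
  case 0
  then show ?case by (auto intro!: continuous_intros)
next
  case (Suc n)
  let ?e = "\<lambda>j. (axis j 1 :: real^'n) $ i"
  have "partial j (\<lambda>x. cos (c * x $ i)) = (\<lambda>x. (- c * ?e j) * sin (c * x $ i))"
    "partial j (\<lambda>x. sin (c * x $ i)) = (\<lambda>x. (c * ?e j) * cos (c * x $ i))" for j
    by (rule ext, subst partial_eqI[OF has_derivative_trig_coordinate(1)]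
        partial_eqI[OF has_derivative_trig_coordinate(2)], simp)+
  moreover have "(\<lambda>x. cos (c * x $ i)) differentiable_on (UNIV :: (real^'n) set)"
    "(\<lambda>x. sin (c * x $ i)) differentiable_on (UNIV :: (real^'n) set)"
    using has_derivative_trig_coordinate by (auto simp: differentiable_on_def differentiable_def; blast)+
  moreover have "Ck n (\<lambda>x::real^'n. - (b * sin (c * x $ i)))" "Ck n (\<lambda>x::real^'n. b * cos (c * x $ i))" for b
    using Ck_mult[OF Ck_const[of n "- b"] Suc[THEN conjunct2]]
      Ck_mult[OF Ck_const[of n b] Suc[THEN conjunct1]] by simp_all
  ultimately show ?case by simp
qed

lemma test_function_add: "test_function \<phi> \<Longrightarrow> test_function \<psi> \<Longrightarrow> test_function (\<lambda>x. \<phi> x + \<psi> x)"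
  by (auto simp: test_function_def periodic_def intro: Ck_add)

lemma test_function_mult: "test_function \<phi> \<Longrightarrow> test_function \<psi> \<Longrightarrow> test_function (\<lambda>x. \<phi> x * \<psi> x)"
  by (auto simp: test_function_def periodic_def intro: Ck_mult)

lemma test_function_const: "test_function (\<lambda>x. c)"
  by (auto simp: test_function_def periodic_def intro: Ck_const)

lemma test_function_trig:
  "test_function (\<lambda>x. cos (2 * pi * x $ i))" "test_function (\<lambda>x. sin (2 * pi * x $ i))"
proof -
  have *: "cos (2 * pi * (x + axis j 1) $ i) = cos (2 * pi * x $ i)"
     "sin (2 * pi * (x + axis j 1) $ i) = sin (2 * pi * x $ i)" for x :: "real^'n" and i j
    by (cases "i = j"; simp add: axis_def distrib_left)+
  show "test_function (\<lambda>x. cos (2 * pi * x $ i))" "test_function (\<lambda>x. sin (2 * pi * x $ i))"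
    using * Ck_trig[of _ "2 * pi" i] by (auto simp: test_function_def periodic_def)
qed

lemma test_function_differentiable:
  "test_function \<phi> \<Longrightarrow> (\<phi> has_derivative frechet_derivative \<phi> (at x)) (at x)"
  by (auto simp: test_function_def intro: has_derivative_Ck)

lemma test_function_continuous: "test_function \<phi> \<Longrightarrow> continuous_on UNIV \<phi>"
  unfolding test_function_def using Ck.simps(1) by blast

lemma test_function_measurable: "test_function \<phi> \<Longrightarrow> \<phi> \<in> borel_measurable borel"
  by (simp add: borel_measurable_continuous_onI test_function_continuous)

text \<open>Holds for arbitrary functions: \<open>frechet_derivative\<close> is a choice among
  derivatives, and translation leaves the set of candidates unchanged, so the choices
  coincide.\<close>

lemma partial_shift: "partial i (\<lambda>x. \<phi> (x + a)) x = partial i \<phi> (x + a)"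
proof -
  have *: "((\<lambda>x. \<phi> (x + a)) has_derivative D) (at x) \<longleftrightarrow> (\<phi> has_derivative D) (at (x + a))" for D
    by (simp add: has_derivative_at add.assoc add.commute[of _ a] add.left_commute[of _ a])
  show ?thesis by (simp add: partial_def frechet_derivative_def *)
qed

lemma test_function_partial: "test_function \<phi> \<Longrightarrow> test_function (partial i \<phi>)"
proof -
  assume \<phi>: "test_function \<phi>"
  have "partial i \<phi> (x + axis j 1) = partial i \<phi> x" for x j
    using \<phi> partial_shift[of i \<phi> "axis j 1" x] by (simp add: test_function_def periodic_def)
  moreover have "Ck n (partial i \<phi>)" for n
    using \<phi> Ck.simps(2) unfolding test_function_def by blast
  ultimately show ?thesis by (simp add: test_function_def periodic_def)
qed

lemma test_function_bounded:
  assumes "test_function \<phi>"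
  obtains B where "B > 0" "\<And>x. \<bar>\<phi> x\<bar> \<le> B"
proof -
  have "bounded (\<phi> ` cbox 0 1)"
    by (intro compact_imp_bounded compact_continuous_image
        continuous_on_subset[OF test_function_continuous[OF assms]]) auto
  then obtain B where B: "B > 0" "\<And>x. x \<in> cbox 0 1 \<Longrightarrow> \<bar>\<phi> x\<bar> \<le> B"
    by (auto simp: bounded_pos)
  have "\<bar>\<phi> x\<bar> \<le> B" for x
  proof -
    obtain z where z: "z \<in> lattice" "x + z \<in> unit_cell" using ex1_lattice_shift[of x] by auto
    have "periodic \<phi>" using assms by (simp add: test_function_def)
    then show ?thesis using B(2)[of "x + z"] z unit_cell_subset periodic_lattice[of \<phi> z x] by auto
  qed
  then show ?thesis using B(1) that by blast
qed

lemma integrable_torus_bounded: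
  fixes g :: "real^'n \<Rightarrow> real"
  assumes "g \<in> borel_measurable borel" "\<And>x. \<bar>g x\<bar> \<le> B"
  shows "integrable torus g"
  using assms by (intro torus.integrable_const_bound[where B=B]) (auto intro: borel_measurable_torus)

lemma integrable_torus_mult_bounded:
  fixes f g :: "real^'n \<Rightarrow> real"
  assumes f: "integrable torus f" and "g \<in> borel_measurable borel" "\<And>x. \<bar>g x\<bar> \<le> B"
  shows "integrable torus (\<lambda>x. f x * g x)"
proof (rule Bochner_Integration.integrable_bound[of torus "\<lambda>x. B * f x"])
  have "0 \<le> B" using assms(3) abs_ge_zero order_trans by blast
  then show "AE x in torus. norm (f x * g x) \<le> norm (B * f x)"
    using assms(3) by (auto simp: abs_mult mult.commute[of _ "\<bar>g _\<bar>"] intro!: mult_right_mono)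
  have "g \<in> borel_measurable torus" using assms(2) by (rule borel_measurable_torus)
  then show "(\<lambda>x. f x * g x) \<in> borel_measurable torus" using f by auto
qed (use f in auto)

lemma integrable_test_function: "test_function \<phi> \<Longrightarrow> integrable torus \<phi>"
  by (metis integrable_torus_bounded test_function_bounded test_function_measurable)

lemma integrable_mult_test_function:
  "integrable torus f \<Longrightarrow> test_function \<phi> \<Longrightarrow> integrable torus (\<lambda>x. f x * \<phi> x)"
  by (metis integrable_torus_mult_bounded test_function_bounded test_function_measurable)

text \<open>Difference quotients in direction \<open>i\<close> integrate to 0 by translation
  invariance, and dominated convergence carries this over to the derivative.\<close>

lemma integral_partial_test_function:
  assumes \<phi>: "test_function \<phi>"
  shows "integral\<^sup>L torus (partial i \<phi>) = 0"
proof -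
  obtain B where B: "B > 0" "\<And>x. \<bar>partial i \<phi> x\<bar> \<le> B"
    using test_function_bounded[OF test_function_partial[OF \<phi>]] by blast
  have deriv: "((\<lambda>t. \<phi> (x + t *\<^sub>R axis i 1)) has_real_derivative partial i \<phi> (x + t *\<^sub>R axis i 1)) (at t within S)"
    for x t S
  proof -
    have "((\<lambda>t. \<phi> (x + t *\<^sub>R axis i 1)) has_derivative
        (\<lambda>s. frechet_derivative \<phi> (at (x + t *\<^sub>R axis i 1)) (s *\<^sub>R axis i 1))) (at t within S)"
      by (rule has_derivative_compose[OF _ test_function_differentiable[OF \<phi>]])
        (auto intro!: derivative_eq_intros)
    moreover have "linear (frechet_derivative \<phi> (at (x + t *\<^sub>R axis i 1)))"
      using test_function_differentiable[OF \<phi>] has_derivative_linear by blast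
    ultimately show ?thesis
      by (simp add: has_field_derivative_def partial_def linear_cmul mult.commute[of _ "frechet_derivative _ _ _"])
  qed
  define q where "q n x = (\<phi> (x + inverse (real (Suc n)) *\<^sub>R axis i 1) - \<phi> x) / inverse (real (Suc n))" for n x
  have shift: "(\<lambda>x. \<phi> (x + a)) \<in> borel_measurable borel" for a
    by (rule measurable_compose[OF _ test_function_measurable[OF \<phi>]]) auto
  have q0: "integral\<^sup>L torus (q n) = 0" for n
  proof -
    have per: "periodic \<phi>" using \<phi> by (simp add: test_function_def)
    note * = torus_shift[OF test_function_measurable[OF \<phi>] per, of "inverse (real (Suc n)) *\<^sub>R axis i 1"]
    have "integral\<^sup>L torus (q n) = (integral\<^sup>L torus (\<lambda>x. \<phi> (x + inverse (real (Suc n)) *\<^sub>R axis i 1)) - integral\<^sup>L torus \<phi>) / inverse (real (Suc n))"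
      unfolding q_def using integrable_test_function[OF \<phi>] *(1)
      by (simp del: of_nat_Suc)
    then show ?thesis using *(2) by simp
  qed
  have "(\<lambda>n. integral\<^sup>L torus (q n)) \<longlonglongrightarrow> integral\<^sup>L torus (partial i \<phi>)"
  proof (rule integral_dominated_convergence[where w="\<lambda>_. B"])
    show "partial i \<phi> \<in> borel_measurable torus"
      by (intro borel_measurable_torus test_function_measurable test_function_partial \<phi>)
    show "q n \<in> borel_measurable torus" for n
      unfolding q_def
      by (intro borel_measurable_torus borel_measurable_divide borel_measurable_diff shift
          test_function_measurable[OF \<phi>] borel_measurable_const)
    show "AE x in torus. (\<lambda>n. q n x) \<longlonglongrightarrow> partial i \<phi> x"
    proof (rule AE_I2)
      fix x
      have "((\<lambda>h. (\<phi> (x + h *\<^sub>R axis i 1) - \<phi> x) / h) \<longlongrightarrow> partial i \<phi> x) (at 0)"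
        using deriv[of x 0 UNIV] by (simp add: DERIV_def)
      moreover have "filterlim (\<lambda>n. inverse (real (Suc n))) (at 0) sequentially"
        using LIMSEQ_inverse_real_of_nat by (auto simp: filterlim_at)
      ultimately show "(\<lambda>n. q n x) \<longlonglongrightarrow> partial i \<phi> x"
        unfolding q_def by (rule filterlim_compose)
    qed
    show "AE x in torus. norm (q n x) \<le> B" for n
    proof (rule AE_I2)
      fix x
      \<comment> \<open>The mean value theorem bounds every quotient by the bound \<open>B\<close>
        of the derivative, which serves as the dominating function.\<close>
      let ?h = "inverse (real (Suc n))"
      have "\<exists>z>0. z < ?h \<and> \<phi> (x + ?h *\<^sub>R axis i 1) - \<phi> (x + 0 *\<^sub>R axis i 1)
          = (?h - 0) * partial i \<phi> (x + z *\<^sub>R axis i 1)"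
        by (rule MVT2[of 0 ?h "\<lambda>t. \<phi> (x + t *\<^sub>R axis i 1)"]) (use deriv in auto)
      then obtain z where "\<phi> (x + ?h *\<^sub>R axis i 1) - \<phi> x = ?h * partial i \<phi> (x + z *\<^sub>R axis i 1)" by auto
      then have "q n x = partial i \<phi> (x + z *\<^sub>R axis i 1)" by (simp add: q_def del: of_nat_Suc)
      then show "norm (q n x) \<le> B" using B(2) by simp
    qed
  qed simp
  then show ?thesis by (simp add: q0 LIMSEQ_const_iff)
qed

lemma partial_mult:
  assumes "test_function \<phi>" "test_function \<psi>"
  shows "partial i (\<lambda>x. \<phi> x * \<psi> x) x = \<phi> x * partial i \<psi> x + partial i \<phi> x * \<psi> x"
  by (subst partial_eqI[OF has_derivative_mult[OF assms[THEN test_function_differentiable]]])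
    (simp add: partial_def)

lemma test_function_Lp: "test_function \<phi> \<Longrightarrow> \<phi> \<in> Lp p"
proof -
  assume \<phi>: "test_function \<phi>"
  obtain B where B: "B > 0" "\<And>x. \<bar>\<phi> x\<bar> \<le> B" using test_function_bounded[OF \<phi>] by blast
  have m: "\<phi> \<in> borel_measurable borel" by (rule test_function_measurable[OF \<phi>])
  have "integrable torus (\<lambda>x. \<bar>\<phi> x\<bar> powr enn2real p)"
    using B m by (intro integrable_torus_bounded[where B="B powr enn2real p"]) (auto intro: powr_mono2)
  then show ?thesis using \<phi> m B by (auto simp: Lp_def test_function_def)
qed

text \<open>The product rule for \<open>\<phi> * \<psi>\<close>, whose partial derivatives integrate
  to 0.\<close>

lemma weak_partial_test_function:
  fixes \<phi> :: "real^'n \<Rightarrow> real"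
  assumes \<phi>: "test_function \<phi>"
  shows "weak_partial i \<phi> (partial i \<phi>)"
  unfolding weak_partial_def
proof (intro conjI allI impI test_function_Lp test_function_partial \<phi>)
  fix \<psi> assume \<psi>: "test_function (\<psi> :: real^'n \<Rightarrow> real)"
  have "integral\<^sup>L torus (\<lambda>x. \<phi> x * partial i \<psi> x + partial i \<phi> x * \<psi> x) = 0"
    using integral_partial_test_function[OF test_function_mult[OF \<phi> \<psi>], of i]
    by (simp add: partial_mult[OF \<phi> \<psi>, abs_def])
  moreover have "integrable torus (\<lambda>x. \<phi> x * partial i \<psi> x)" "integrable torus (\<lambda>x. partial i \<phi> x * \<psi> x)"
    by (intro integrable_test_function test_function_mult test_function_partial \<phi> \<psi>)+
  ultimately show "integral\<^sup>L torus (\<lambda>x. \<phi> x * partial i \<psi> x) = - integral\<^sup>L torus (\<lambda>x. partial i \<phi> x * \<psi> x)"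
    by simp
qed

lemma test_function_H1: "test_function \<phi> \<Longrightarrow> \<phi> \<in> H1"
  by (auto simp: test_function_Lp test_function_partial intro!: bexI[of _ "partial _ \<phi>"] weak_partial_test_function
      test_function_partial)

section \<open>Continuity of correlations\<close>

lemma Lp_1_iff: "u \<in> Lp 1 \<longleftrightarrow> periodic u \<and> u \<in> borel_measurable borel \<and> integrable torus u"
proof -
  have "integrable torus (\<lambda>x. \<bar>u x\<bar>) \<longleftrightarrow> integrable torus u" if "u \<in> borel_measurable borel"
    using integrable_norm_iff[OF borel_measurable_torus[OF that]] by simp
  then show ?thesis by (auto simp: Lp_def)
qed

lemma Lp_2_iff: "u \<in> Lp 2 \<longleftrightarrow> periodic u \<and> u \<in> borel_measurable borel \<and> integrable torus (\<lambda>x. (u x)\<^sup>2)"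
  by (auto simp: Lp_def)

lemma integrable_mult_Lp_2:
  assumes "u \<in> Lp 2" "v \<in> Lp 2"
  shows "integrable torus (\<lambda>x. u x * v x)"
proof (rule Bochner_Integration.integrable_bound[of torus "\<lambda>x. (u x)\<^sup>2 + (v x)\<^sup>2"])
  show "integrable torus (\<lambda>x. (u x)\<^sup>2 + (v x)\<^sup>2)" using assms by (auto simp: Lp_2_iff)
  have "u \<in> borel_measurable torus" "v \<in> borel_measurable torus"
    using assms by (auto simp: Lp_2_iff intro: borel_measurable_torus)
  then show "(\<lambda>x. u x * v x) \<in> borel_measurable torus" by measurable
  have "\<bar>a * b\<bar> \<le> a\<^sup>2 + b\<^sup>2" for a b :: real
  proof -
    have "0 \<le> (\<bar>a\<bar> - \<bar>b\<bar>)\<^sup>2" by simp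
    then have "2 * \<bar>a * b\<bar> \<le> a\<^sup>2 + b\<^sup>2" by (simp add: power2_diff abs_mult)
    then show ?thesis using abs_ge_zero[of "a * b"] by linarith
  qed
  then show "AE x in torus. norm (u x * v x) \<le> norm ((u x)\<^sup>2 + (v x)\<^sup>2)" by simp
qed

lemma const_Lp: "(\<lambda>x. c) \<in> Lp p"
  by (rule test_function_Lp[OF test_function_const])

lemma Lp_2_subset_1: "u \<in> Lp 2 \<Longrightarrow> u \<in> Lp 1"
  using integrable_mult_Lp_2[OF _ const_Lp[of 1 2], of u] by (auto simp: Lp_1_iff Lp_2_iff)

lemma periodic_shift: "periodic u \<Longrightarrow> periodic (\<lambda>x. u (x + a))"
  by (simp add: periodic_def add.assoc add.commute[of _ a]) (simp add: add.assoc[symmetric])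

lemma measurable_shift:
  fixes u :: "real^'n \<Rightarrow> real"
  shows "u \<in> borel_measurable borel \<Longrightarrow> (\<lambda>x. u (x + a)) \<in> borel_measurable borel"
  by (rule measurable_compose[of "\<lambda>x. x + a"]) auto

lemma Lp_2_shift: "u \<in> Lp 2 \<Longrightarrow> (\<lambda>x. u (x + a)) \<in> Lp 2"
  using integrable_torus_shift[of "\<lambda>x. (u x)\<^sup>2" a]
  by (auto simp: Lp_2_iff periodic_shift measurable_shift) (auto simp: periodic_def)

section \<open>Translates of bounded functions in the mean\<close>

lemma integral_lborel_shift:
  fixes f :: "'a::euclidean_space \<Rightarrow> real"
  assumes [measurable]: "f \<in> borel_measurable borel"
  shows "(integrable lborel (\<lambda>x. f (x + z)) \<longleftrightarrow> integrable lborel f) \<and> integral\<^sup>L lborel (\<lambda>x. f (x + z)) = integral\<^sup>L lborel f"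
  using integrable_distr_eq[of "(+) z" lborel borel f] integral_distr[of "(+) z" lborel borel f]
  by (simp add: lborel_distr_plus add.commute)

lemma measure_torus_le: "measure torus (unit_cell :: (real^'n) set) \<le> 1"
proof -
  have "measure torus (unit_cell :: (real^'n) set) = measure lborel (unit_cell :: (real^'n) set)"
    by (simp add: torus_def measure_restrict_space)
  also have "\<dots> \<le> measure lborel (cbox 0 (1::real^'n))"
    by (intro measure_mono_fmeasurable unit_cell_subset) auto
  also have "\<dots> = 1"
  proof -
    have "(1::real^'n) \<bullet> b = 1" if "b \<in> Basis" for b
      using that by (auto simp: Basis_vec_def inner_axis)
    then show ?thesis by (simp add: measure_lborel_cbox_eq)
  qed
  finally show ?thesis .
qed

text \<open>Measurability supplies continuous functions converging to \<open>m\<close> off a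
  negligible set. One of them is close to \<open>m\<close> in the mean, and uniform continuity
  controls its translates; three errors of size \<open>e / 3\<close> result.\<close>

lemma L1_translation_bounded:
  fixes m :: "real^'n \<Rightarrow> real"
  assumes m [measurable]: "m \<in> borel_measurable borel" and B: "\<And>x. \<bar>m x\<bar> \<le> B" and "e > 0"
  obtains d where "d > 0" "\<And>z. norm z < d \<Longrightarrow> (\<integral>x. \<bar>m (x + z) - m x\<bar> \<partial>torus) \<le> e"
proof -
  have B0: "0 \<le> B" using B abs_ge_zero order_trans by blast
  \<comment> \<open>This cube contains the cell and all its translates by vectors of norm below
    1.\<close>
  let ?Q = "cbox (-1) 2 :: (real^'n) set"
  have "m \<in> borel_measurable lebesgue" by (rule measurable_completion) simp
  then have "m measurable_on UNIV" by (rule lebesgue_measurable_imp_measurable_on) simp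
  then obtain N g where N: "negligible N" and g: "\<And>n. continuous_on UNIV (g n)"
    and lim: "\<And>x. x \<notin> N \<Longrightarrow> (\<lambda>n. g n x) \<longlonglongrightarrow> m x"
    by (auto simp: measurable_on_def)
  \<comment> \<open>Truncation at \<open>B\<close> provides a dominating function and keeps the
    limit, since \<open>m\<close> itself is bounded by \<open>B\<close>.\<close>
  define g' where "g' n x = max (- B) (min B (g n x))" for n x
  have g': "continuous_on UNIV (g' n)" for n
    unfolding g'_def by (intro continuous_intros g)
  have [measurable]: "g' n \<in> borel_measurable borel" for n
    by (intro borel_measurable_continuous_onI g')
  have g'B: "\<bar>g' n x\<bar> \<le> B" for n x using B0 by (auto simp: g'_def)
  have lim': "(\<lambda>n. g' n x) \<longlonglongrightarrow> m x" if "x \<notin> N" for x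
  proof -
    have "(\<lambda>n. g' n x) \<longlonglongrightarrow> max (- B) (min B (m x))"
      unfolding g'_def by (intro tendsto_intros lim that)
    then show ?thesis using B[of x] by (simp add: abs_le_iff max_def min_def split: if_splits)
  qed
  have "AE x in lebesgue. x \<notin> N" using N by (simp add: negligible_iff_null_sets AE_not_in)
  then have ae: "AE x in lborel. x \<notin> N" by (simp add: AE_completion_iff)
  let ?D = "\<lambda>n x. indicator ?Q x * \<bar>m x - g' n x\<bar>"
  have intQ: "integrable lborel (\<lambda>x. indicator ?Q x * c)" for c :: real
    by (intro integrable_mult_left integrable_real_indicator) (auto simp: emeasure_lborel_cbox_eq)
  have "(\<lambda>n. integral\<^sup>L lborel (?D n)) \<longlonglongrightarrow> integral\<^sup>L lborel (\<lambda>x::real^'n. 0)"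
  proof (rule integral_dominated_convergence[where w="\<lambda>x. indicator ?Q x * (2 * B)"])
    show "AE x in lborel. (\<lambda>n. ?D n x) \<longlonglongrightarrow> 0"
      using ae
    proof eventually_elim
      fix x assume "x \<notin> N"
      then have "(\<lambda>n. ?D n x) \<longlonglongrightarrow> indicator ?Q x * \<bar>m x - m x\<bar>"
        by (intro tendsto_intros lim')
      then show "(\<lambda>n. ?D n x) \<longlonglongrightarrow> 0" by simp
    qed
    show "AE x in lborel. norm (?D n x) \<le> indicator ?Q x * (2 * B)" for n
    proof (rule AE_I2)
      fix x
      have "\<bar>m x - g' n x\<bar> \<le> 2 * B" using B[of x] g'B[of n x] by linarith
      then show "norm (?D n x) \<le> indicator ?Q x * (2 * B)" by (auto simp: indicator_def)
    qed
  qed (use intQ in auto)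
  then have "\<forall>\<^sub>F n in sequentially. integral\<^sup>L lborel (?D n) < e / 3"
    using \<open>e > 0\<close> by (intro order_tendstoD(2)[where a="e/3"]) auto
  then obtain n where n: "integral\<^sup>L lborel (?D n) < e / 3" by (auto simp: eventually_sequentially)
  have Dint: "integrable lborel (?D n)"
  proof (rule Bochner_Integration.integrable_bound[OF intQ[of "2 * B"]])
    have "\<bar>m x - g' n x\<bar> \<le> 2 * B" for x using B[of x] g'B[of n x] by linarith
    then show "AE x in lborel. norm (?D n x) \<le> norm (indicator ?Q x * (2 * B))"
      using B0 by (auto simp: indicator_def)
  qed measurable
  have "uniformly_continuous_on ?Q (g' n)"
    by (intro compact_uniformly_continuous continuous_on_subset[OF g']) auto
  then obtain d where d: "d > 0"
    "\<And>x y. x \<in> ?Q \<Longrightarrow> y \<in> ?Q \<Longrightarrow> dist y x < d \<Longrightarrow> dist (g' n y) (g' n x) < e / 3"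
    using \<open>e > 0\<close> unfolding uniformly_continuous_on_def by (metis divide_pos_pos zero_less_numeral)
  show ?thesis
  proof (rule that[of "min d 1"])
    show "0 < min d 1" using d by simp
    fix z :: "real^'n" assume z: "norm z < min d 1"
    have zi: "\<bar>z $ i\<bar> < 1" for i using component_le_norm_cart[of z i] z by linarith
    have inQ: "x \<in> ?Q" "x + z \<in> ?Q" if "x \<in> unit_cell" for x
      using that zi by (auto simp: unit_cell_def mem_box_cart) (smt (verit))+
    have bound: "(\<integral>x. \<bar>m (x + a) - g' n (x + a)\<bar> \<partial>torus) < e / 3"
       if "\<And>x. x \<in> unit_cell \<Longrightarrow> x + a \<in> ?Q" for a
    proof -
      have "(\<integral>x. \<bar>m (x + a) - g' n (x + a)\<bar> \<partial>torus) = (\<integral>x. indicator unit_cell x * \<bar>m (x + a) - g' n (x + a)\<bar> \<partial>lborel)"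
        by (simp add: torus_def integral_restrict_space)
      also have "\<dots> \<le> (\<integral>x. ?D n (x + a) \<partial>lborel)"
      proof (rule integral_mono')
        show "integrable lborel (\<lambda>x. ?D n (x + a))"
          using Dint integral_lborel_shift[of "?D n" a] by simp
      qed (use that in \<open>auto simp: indicator_def\<close>)
      also have "\<dots> = integral\<^sup>L lborel (?D n)"
        using integral_lborel_shift[of "?D n" a] by simp
      finally show ?thesis using n by simp
    qed
    have i1: "integrable torus (\<lambda>x. \<bar>m (x + a) - g' n (x + a)\<bar>)" for a
    proof (rule integrable_torus_bounded[where B="2 * B"])
      show "(\<lambda>x. \<bar>m (x + a) - g' n (x + a)\<bar>) \<in> borel_measurable borel" by measurable
      show "\<bar>\<bar>m (x + a) - g' n (x + a)\<bar>\<bar> \<le> 2 * B" for x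
        using B[of "x + a"] g'B[of n "x + a"] by linarith
    qed
    have "(\<integral>x. \<bar>m (x + z) - m x\<bar> \<partial>torus)
      \<le> (\<integral>x. \<bar>m (x + z) - g' n (x + z)\<bar> + e / 3 + \<bar>m (x + 0) - g' n (x + 0)\<bar> \<partial>torus)"
    proof (rule integral_mono')
      show "integrable torus (\<lambda>x. \<bar>m (x + z) - g' n (x + z)\<bar> + e / 3 + \<bar>m (x + 0) - g' n (x + 0)\<bar>)"
        by (intro Bochner_Integration.integrable_add i1) simp
      fix x :: "real^'n" assume x: "x \<in> space torus"
      have "dist (x + z) x < d" using z by (simp add: dist_norm)
      then have "dist (g' n (x + z)) (g' n x) < e / 3" using d(2)[of x "x + z"] inQ[of x] x by simp
      then show "\<bar>m (x + z) - m x\<bar> \<le> \<bar>m (x + z) - g' n (x + z)\<bar> + e / 3 + \<bar>m (x + 0) - g' n (x + 0)\<bar>"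
        unfolding dist_real_def by (simp only: add_0_right)
    next
      fix x :: "real^'n"
      show "0 \<le> \<bar>m (x + z) - g' n (x + z)\<bar> + e / 3 + \<bar>m (x + 0) - g' n (x + 0)\<bar>"
        using \<open>e > 0\<close> by simp
    qed
    also have "\<dots> = (\<integral>x. \<bar>m (x + z) - g' n (x + z)\<bar> \<partial>torus) + e / 3 * measure torus (unit_cell :: (real^'n) set)
         + (\<integral>x. \<bar>m (x + 0) - g' n (x + 0)\<bar> \<partial>torus)"
      using i1[of z] i1[of 0] by simp
    also have "\<dots> \<le> e / 3 + e / 3 * 1 + e / 3"
      using bound[of z] bound[of 0] inQ measure_torus_le \<open>e > 0\<close>
      by (intro add_mono mult_left_mono) (auto simp: less_imp_le)
    finally show "(\<integral>x. \<bar>m (x + z) - m x\<bar> \<partial>torus) \<le> e" by simp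
  qed
qed

definition clip :: "nat \<Rightarrow> real \<Rightarrow> real" where
  "clip k t = max (- real k) (min (real k) t)"

lemma abs_clip_le: "\<bar>clip k t\<bar> \<le> k"
  by (auto simp: clip_def)

lemma abs_diff_clip_le: "\<bar>t - clip k t\<bar> \<le> \<bar>t\<bar>"
  by (auto simp: clip_def)

lemma measurable_clip [measurable]: "clip k \<in> borel_measurable borel"
  unfolding clip_def[abs_def] by measurable

text \<open>The remainder vanishes at \<open>x\<close> once \<open>k\<close> exceeds
  \<open>\<bar>w x\<bar>\<close>, and its power is dominated by that of \<open>w\<close>. The
  exponents used are 1 and 2.\<close>

lemma clip_power_tendsto_0:
  fixes w :: "real^'n \<Rightarrow> real"
  assumes w [measurable]: "w \<in> borel_measurable borel" and int: "integrable torus (\<lambda>x. \<bar>w x\<bar> ^ p)" and "p > 0"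
  shows "(\<lambda>k. \<integral>x. \<bar>w x - clip k (w x)\<bar> ^ p \<partial>torus) \<longlonglongrightarrow> 0"
proof -
  have [measurable]: "w \<in> borel_measurable torus" by (intro borel_measurable_torus w)
  have "(\<lambda>k. \<integral>x. \<bar>w x - clip k (w x)\<bar> ^ p \<partial>torus) \<longlonglongrightarrow> integral\<^sup>L torus (\<lambda>x::real^'n. 0)"
  proof (rule integral_dominated_convergence[where w="\<lambda>x. \<bar>w x\<bar> ^ p"])
    show "AE x in torus. (\<lambda>k. \<bar>w x - clip k (w x)\<bar> ^ p) \<longlonglongrightarrow> 0"
    proof (intro AE_I2 tendsto_eventually)
      fix x
      obtain n where "\<bar>w x\<bar> \<le> real n" using real_arch_simple by blast
      then have "\<bar>w x - clip k (w x)\<bar> ^ p = 0" if "k \<ge> n" for k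
        using that \<open>p > 0\<close> by (auto simp: clip_def)
      then show "\<forall>\<^sub>F k in sequentially. \<bar>w x - clip k (w x)\<bar> ^ p = 0"
        unfolding eventually_sequentially by blast
    qed
    show "AE x in torus. norm (\<bar>w x - clip k (w x)\<bar> ^ p) \<le> \<bar>w x\<bar> ^ p" for k
      by (intro AE_I2) (simp add: power_mono abs_diff_clip_le)
  qed (use int in auto)
  then show ?thesis by simp
qed

text \<open>The cross-correlation of \<open>w\<close> and \<open>m\<close>. Its value at 0 is the
  integral of \<open>w * m\<close>, and its kernel averages are the integrals of \<open>w\<close>
  against mollifications of \<open>m\<close>.\<close>

definition corr :: "(real^'n \<Rightarrow> real) \<Rightarrow> (real^'n \<Rightarrow> real) \<Rightarrow> real^'n \<Rightarrow> real" where
  "corr w m z = (\<integral>x. w x * m (x + z) \<partial>torus)"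

text \<open>Truncate \<open>w\<close>: its bounded part is handled by
  \<open>L1_translation_bounded\<close>, while the remainder is small in the mean and is multiplied
  by a difference of size at most \<open>2 * B\<close>.\<close>

lemma corr_tendsto_bounded:
  fixes w m :: "real^'n \<Rightarrow> real"
  assumes w: "w \<in> Lp 1" and m: "m \<in> borel_measurable borel" "\<And>x. \<bar>m x\<bar> \<le> B"
  shows "(corr w m \<longlongrightarrow> corr w m 0) (at 0)"
proof (rule LIM_I)
  fix e :: real assume "e > 0"
  have B0: "0 \<le> B" using m(2) abs_ge_zero order_trans by blast
  have w': "w \<in> borel_measurable borel" "integrable torus w" using w by (auto simp: Lp_1_iff)
  have "(\<lambda>k. \<integral>x. \<bar>w x - clip k (w x)\<bar> ^ 1 \<partial>torus) \<longlonglongrightarrow> 0"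
    using w' by (intro clip_power_tendsto_0) auto
  \<comment> \<open>The remainder will contribute at most \<open>e / 2\<close> and the bounded part
    at most \<open>e / 4\<close>. The added 1, here and in the choice of \<open>d\<close>, covers
    \<open>B = 0\<close> and \<open>k = 0\<close>.\<close>
  moreover have "0 < e / (4 * (B + 1))" using \<open>e > 0\<close> B0 by simp
  ultimately have "\<forall>\<^sub>F k in sequentially. (\<integral>x. \<bar>w x - clip k (w x)\<bar> ^ 1 \<partial>torus) < e / (4 * (B + 1))"
    by (rule order_tendstoD)
  then obtain k where k: "(\<integral>x. \<bar>w x - clip k (w x)\<bar> \<partial>torus) < e / (4 * (B + 1))"
    by (auto simp: eventually_sequentially)
  obtain d where d: "d > 0"
    "\<And>z. norm z < d \<Longrightarrow> (\<integral>x. \<bar>m (x + z) - m x\<bar> \<partial>torus) \<le> e / (4 * (real k + 1))"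
    using L1_translation_bounded[OF m, of "e / (4 * (real k + 1))"] \<open>e > 0\<close> by auto
  show "\<exists>s>0. \<forall>z. z \<noteq> 0 \<and> norm (z - 0) < s \<longrightarrow> norm (corr w m z - corr w m 0) < e"
  proof (intro exI[of _ d] conjI allI impI d(1))
    fix z :: "real^'n" assume "z \<noteq> 0 \<and> norm (z - 0) < d"
    then have z: "norm z < d" by simp
    have mz: "(\<lambda>x. m (x + z)) \<in> borel_measurable borel" by (rule measurable_shift[OF m(1)])
    have i: "integrable torus (\<lambda>x. w x * m (x + z))" "integrable torus (\<lambda>x. w x * m x)"
      using integrable_torus_mult_bounded[OF w'(2) mz m(2)] integrable_torus_mult_bounded[OF w'(2) m] by auto
    have ck: "(\<lambda>x. clip k (w x)) \<in> borel_measurable borel" using w'(1) by measurable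
    have j1: "integrable torus (\<lambda>x. \<bar>w x - clip k (w x)\<bar>)"
      by (intro integrable_abs Bochner_Integration.integrable_diff w' integrable_torus_bounded[OF ck abs_clip_le])
    have j2: "integrable torus (\<lambda>x. \<bar>m (x + z) - m x\<bar>)"
      by (intro integrable_abs Bochner_Integration.integrable_diff integrable_torus_bounded[OF mz m(2)]
          integrable_torus_bounded[OF m])
    have "corr w m z - corr w m 0 = (\<integral>x. w x * m (x + z) - w x * m x \<partial>torus)"
      using i by (simp add: corr_def)
    then have "\<bar>corr w m z - corr w m 0\<bar> \<le> (\<integral>x. \<bar>w x * m (x + z) - w x * m x\<bar> \<partial>torus)"
      by (simp add: integral_abs_bound)
    also have "\<dots> \<le> (\<integral>x. 2 * B * \<bar>w x - clip k (w x)\<bar> + real k * \<bar>m (x + z) - m x\<bar> \<partial>torus)"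
    proof (rule integral_mono)
      fix x
      have "w x * m (x + z) - w x * m x = (w x - clip k (w x)) * (m (x + z) - m x) + clip k (w x) * (m (x + z) - m x)"
        by (simp add: algebra_simps)
      then have "\<bar>w x * m (x + z) - w x * m x\<bar>
          \<le> \<bar>w x - clip k (w x)\<bar> * \<bar>m (x + z) - m x\<bar> + \<bar>clip k (w x)\<bar> * \<bar>m (x + z) - m x\<bar>"
        by (metis abs_mult abs_triangle_ineq)
      also have "\<dots> \<le> \<bar>w x - clip k (w x)\<bar> * (2 * B) + real k * \<bar>m (x + z) - m x\<bar>"
        using m(2)[of x] m(2)[of "x + z"]
        by (intro add_mono mult_left_mono mult_right_mono abs_clip_le) auto
      finally show "\<bar>w x * m (x + z) - w x * m x\<bar> \<le> 2 * B * \<bar>w x - clip k (w x)\<bar> + real k * \<bar>m (x + z) - m x\<bar>"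
        by (simp add: mult.commute)
    qed (use i j1 j2 in \<open>auto intro!: integrable_abs\<close>)
    also have "\<dots> = 2 * B * (\<integral>x. \<bar>w x - clip k (w x)\<bar> \<partial>torus) + real k * (\<integral>x. \<bar>m (x + z) - m x\<bar> \<partial>torus)"
      using j1 j2 by simp
    also have "\<dots> \<le> 2 * B * (e / (4 * (B + 1))) + real k * (e / (4 * (real k + 1)))"
      using k d(2)[OF z] B0 by (intro add_mono mult_left_mono) auto
    also have "\<dots> \<le> e / 2 + e / 4"
      using B0 \<open>e > 0\<close> by (intro add_mono) (auto simp: field_simps)
    finally show "norm (corr w m z - corr w m 0) < e" using \<open>e > 0\<close> by simp
  qed
qed

text \<open>Now \<open>m\<close> is truncated. The remainder \<open>r\<close> is small in the square
  mean, and translation invariance makes its correlation with \<open>w\<close> small uniformly in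
  \<open>z\<close>, through a weighted Young inequality in place of Cauchy-Schwarz.\<close>

lemma corr_tendsto_Lp_2:
  fixes w m :: "real^'n \<Rightarrow> real"
  assumes w: "w \<in> Lp 2" and m: "m \<in> Lp 2"
  shows "(corr w m \<longlongrightarrow> corr w m 0) (at 0)"
proof (rule LIM_I)
  fix e :: real assume "e > 0"
  define W where "W = (\<integral>x. (w x)\<^sup>2 \<partial>torus)"
  have W0: "W \<ge> 0" unfolding W_def by simp
  \<comment> \<open>The weight in Young's inequality: \<open>c / 2 * W\<close> is at most
    \<open>e / 4\<close> and the other term at most \<open>e / 8\<close>. The two remainders thus
    cost \<open>3 * e / 4\<close>, leaving \<open>e / 4\<close> for the bounded part.\<close>
  define c where "c = e / (2 * (W + 1))"
  have c0: "c > 0" using \<open>e > 0\<close> W0 by (simp add: c_def)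
  have m': "m \<in> borel_measurable borel" "periodic m" "integrable torus (\<lambda>x. (m x)\<^sup>2)"
    using m by (auto simp: Lp_2_iff)
  have "(\<lambda>k. \<integral>x. \<bar>m x - clip k (m x)\<bar> ^ 2 \<partial>torus) \<longlonglongrightarrow> 0"
    using m' by (intro clip_power_tendsto_0) auto
  moreover have "0 < c * e / 4" using \<open>e > 0\<close> c0 by simp
  ultimately have "\<forall>\<^sub>F k in sequentially. (\<integral>x. \<bar>m x - clip k (m x)\<bar> ^ 2 \<partial>torus) < c * e / 4"
    by (rule order_tendstoD)
  then obtain k where k: "(\<integral>x. (m x - clip k (m x))\<^sup>2 \<partial>torus) < c * e / 4"
    by (auto simp: eventually_sequentially)
  define b where "b x = clip k (m x)" for x
  define r where "r x = m x - b x" for x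
  have b: "b \<in> borel_measurable borel" "\<And>x. \<bar>b x\<bar> \<le> k" "periodic b"
    unfolding b_def using m' by (auto simp: abs_clip_le periodic_def)
  have b2: "b \<in> Lp 2" unfolding Lp_2_iff using b
    by (auto intro!: integrable_torus_bounded[where B="(real k)\<^sup>2"] simp: abs_le_square_iff[symmetric])
  have r2: "r \<in> Lp 2" unfolding Lp_2_iff
  proof (intro conjI)
    show "periodic r" "r \<in> borel_measurable borel" using m' b unfolding r_def by (auto simp: periodic_def)
    have "integrable torus (\<lambda>x. m x * m x + b x * b x - 2 * (m x * b x))"
      by (intro Bochner_Integration.integrable_diff Bochner_Integration.integrable_add integrable_mult_right
          integrable_mult_Lp_2 m b2)
    then show "integrable torus (\<lambda>x. (r x)\<^sup>2)"
      by (simp add: r_def power2_eq_square algebra_simps)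
  qed
  have "(corr w b \<longlongrightarrow> corr w b 0) (at 0)"
    using corr_tendsto_bounded[OF Lp_2_subset_1[OF w] b(1,2)] .
  from LIM_D[OF this, of "e / 4"] \<open>e > 0\<close>
  obtain d where d: "d > 0" "\<And>z. z \<noteq> 0 \<Longrightarrow> norm z < d \<Longrightarrow> \<bar>corr w b z - corr w b 0\<bar> < e / 4" by auto
  have split: "corr w m z = corr w b z + corr w r z" for z
  proof -
    have "corr w m z = (\<integral>x. w x * b (x + z) + w x * r (x + z) \<partial>torus)"
      unfolding corr_def by (intro Bochner_Integration.integral_cong) (auto simp: r_def algebra_simps)
    then show ?thesis unfolding corr_def
      using integrable_mult_Lp_2[OF w Lp_2_shift[OF b2, of z]] integrable_mult_Lp_2[OF w Lp_2_shift[OF r2, of z]]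
      by simp
  qed
  have small: "\<bar>corr w r z\<bar> \<le> 3 * e / 8" for z
  proof -
    have "\<bar>corr w r z\<bar> \<le> (\<integral>x. \<bar>w x * r (x + z)\<bar> \<partial>torus)"
      unfolding corr_def by (rule integral_abs_bound)
    also have "\<dots> \<le> (\<integral>x. c / 2 * (w x)\<^sup>2 + 1 / (2 * c) * (r (x + z))\<^sup>2 \<partial>torus)"
    proof (rule integral_mono)
      show "integrable torus (\<lambda>x. \<bar>w x * r (x + z)\<bar>)"
        by (intro integrable_abs integrable_mult_Lp_2 w Lp_2_shift r2)
      show "integrable torus (\<lambda>x. c / 2 * (w x)\<^sup>2 + 1 / (2 * c) * (r (x + z))\<^sup>2)"
        using w Lp_2_shift[OF r2, of z] by (auto simp: Lp_2_iff)
      fix x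
      have "0 \<le> (c * \<bar>w x\<bar> - \<bar>r (x + z)\<bar>)\<^sup>2" by simp
      then have "2 * c * (\<bar>w x\<bar> * \<bar>r (x + z)\<bar>) \<le> c\<^sup>2 * (w x)\<^sup>2 + (r (x + z))\<^sup>2"
        by (simp add: power2_diff power_mult_distrib algebra_simps)
      then show "\<bar>w x * r (x + z)\<bar> \<le> c / 2 * (w x)\<^sup>2 + 1 / (2 * c) * (r (x + z))\<^sup>2"
        using c0 by (simp add: field_simps abs_mult power2_eq_square)
    qed
    also have "\<dots> = c / 2 * W + 1 / (2 * c) * (\<integral>x. (r (x + z))\<^sup>2 \<partial>torus)"
      using w Lp_2_shift[OF r2, of z] by (simp add: Lp_2_iff W_def)
    also have "(\<integral>x. (r (x + z))\<^sup>2 \<partial>torus) = (\<integral>x. (r x)\<^sup>2 \<partial>torus)"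
      using r2 by (intro integral_torus_shift[of "\<lambda>x. (r x)\<^sup>2"]) (auto simp: Lp_2_iff periodic_def)
    also have "c / 2 * W + 1 / (2 * c) * (\<integral>x. (r x)\<^sup>2 \<partial>torus) \<le> e / 4 + 1 / (2 * c) * (c * e / 4)"
    proof (intro add_mono mult_left_mono)
      show "c / 2 * W \<le> e / 4" using W0 \<open>e > 0\<close> by (simp add: c_def field_simps)
      show "(\<integral>x. (r x)\<^sup>2 \<partial>torus) \<le> c * e / 4" using k by (simp add: r_def b_def)
    qed (use c0 in auto)
    also have "\<dots> = 3 * e / 8" using c0 by simp
    finally show ?thesis .
  qed
  show "\<exists>s>0. \<forall>z. z \<noteq> 0 \<and> norm (z - 0) < s \<longrightarrow> norm (corr w m z - corr w m 0) < e"
  proof (intro exI[of _ d] conjI allI impI d(1))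
    fix z :: "real^'n" assume "z \<noteq> 0 \<and> norm (z - 0) < d"
    then have "\<bar>corr w b z - corr w b 0\<bar> < e / 4" using d(2) by simp
    then show "norm (corr w m z - corr w m 0) < e"
      using split[of z] split[of 0] small[of z] small[of 0] unfolding real_norm_def by linarith
  qed
qed

text \<open>Continuity at \<open>a\<close> is continuity at 0 for the translate of \<open>m\<close>
  by \<open>a\<close>.\<close>

lemma continuous_on_corr:
  assumes "\<And>a. (corr w (\<lambda>x. m (x + a)) \<longlongrightarrow> corr w (\<lambda>x. m (x + a)) 0) (at 0)"
  shows "continuous_on UNIV (corr w m)"
proof -
  have "isCont (corr w m) a" for a
  proof -
    have "corr w (\<lambda>x. m (x + a)) = (\<lambda>z. corr w m (a + z))"
      by (simp add: fun_eq_iff corr_def add.assoc add.commute[of a])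
    then show ?thesis using assms[of a] by (simp add: isCont_iff)
  qed
  then show ?thesis by (simp add: continuous_at_imp_continuous_on)
qed

lemma continuous_on_corr_bounded:
  "w \<in> Lp 1 \<Longrightarrow> m \<in> borel_measurable borel \<Longrightarrow> (\<And>x. \<bar>m x\<bar> \<le> B) \<Longrightarrow> continuous_on UNIV (corr w m)"
  by (intro continuous_on_corr corr_tendsto_bounded[where B=B] measurable_shift)

lemma continuous_on_corr_Lp_2:
  "w \<in> Lp 2 \<Longrightarrow> m \<in> Lp 2 \<Longrightarrow> continuous_on UNIV (corr w m)"
  by (intro continuous_on_corr corr_tendsto_Lp_2 Lp_2_shift)

section \<open>Mollification\<close>

definition bump :: "real^'n \<Rightarrow> real" where
  "bump x = (\<Prod>i\<in>UNIV. (1 + cos (2 * pi * x $ i)) / 2)"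

text \<open>Since \<open>(1 + cos t) / 2\<close> is the square of \<open>cos (t / 2)\<close>, this
  is a product of de la Vallee-Poussin kernels without the normalizing constant; the integral is
  divided out where a limit is taken.\<close>

definition cos_kernel :: "nat \<Rightarrow> real^'n \<Rightarrow> real" where
  "cos_kernel n x = bump x ^ n"

lemma bump_factor_bounds: "0 \<le> (1 + cos t) / 2" "(1 + cos t) / 2 \<le> (1::real)"
proof -
  have "0 \<le> (1 + c) / 2 \<and> (1 + c) / 2 \<le> 1" if "- 1 \<le> c" "c \<le> 1" for c :: real
    using that by simp
  from this[OF cos_ge_minus_one cos_le_one]
  show "0 \<le> (1 + cos t) / 2" "(1 + cos t) / 2 \<le> 1" by simp_all
qed

lemma bump_bounds: "0 \<le> bump x" "bump x \<le> 1"
proof -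
  note * = bump_factor_bounds
  show "0 \<le> bump x" "bump x \<le> 1"
    unfolding bump_def using * by (auto intro: prod_nonneg prod_le_1)
qed

text \<open>All factors lie in [0, 1], so the product reaches 1 only if every cosine does. Hence the
  powers of \<open>bump\<close> concentrate at the lattice.\<close>

lemma bump_eq_1_imp_lattice:
  assumes "bump x = 1"
  shows "x \<in> lattice"
proof -
  note * = bump_factor_bounds
  have "x $ i \<in> \<int>" for i
  proof -
    have "bump x = (1 + cos (2 * pi * x $ i)) / 2 * (\<Prod>j\<in>UNIV - {i}. (1 + cos (2 * pi * x $ j)) / 2)"
      unfolding bump_def by (rule prod.remove) auto
    also have "\<dots> \<le> (1 + cos (2 * pi * x $ i)) / 2 * 1"
      using * by (intro mult_left_mono prod_le_1) auto
    finally have "cos (2 * pi * x $ i) = 1" using assms cos_le_one[of "2 * pi * x $ i"] by simp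
    then obtain n :: int where "2 * pi * x $ i = n * 2 * pi" by (auto simp: cos_one_2pi_int)
    then have "x $ i = of_int n" by simp
    then show ?thesis by simp
  qed
  then show ?thesis by (simp add: lattice_def)
qed

lemma bump_0: "bump 0 = 1"
  by (simp add: bump_def)

lemma bump_uminus: "bump (- x) = bump x"
  by (simp add: bump_def)

lemma test_function_prod:
  "finite S \<Longrightarrow> (\<And>i. i \<in> S \<Longrightarrow> test_function (\<phi> i)) \<Longrightarrow> test_function (\<lambda>x. \<Prod>i\<in>S. \<phi> i x)"
  by (induction S rule: finite_induct) (auto intro: test_function_const test_function_mult)

lemma test_function_bump: "test_function bump"
proof -
  have "test_function (\<lambda>x. (1 + cos (2 * pi * x $ i)) * (1 / 2))" for i
    by (intro test_function_mult test_function_add test_function_trig test_function_const)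
  then show ?thesis
    unfolding bump_def[abs_def] by (intro test_function_prod) auto
qed

lemma test_function_cos_kernel: "test_function (cos_kernel n)"
proof -
  have "test_function (\<lambda>x. bump x ^ n)"
    by (induction n) (auto intro: test_function_const test_function_mult test_function_bump)
  then show ?thesis by (simp add: cos_kernel_def[abs_def])
qed

lemma cos_kernel_nonneg: "0 \<le> cos_kernel n x"
  by (simp add: cos_kernel_def bump_bounds)

lemma cos_kernel_le_1: "cos_kernel n x \<le> 1"
  by (simp add: cos_kernel_def bump_bounds power_le_one)

text \<open>The origin is a corner of the half-open cell, so no ball around it lies inside. It is
  however in the closure of the open box, which \<open>U\<close> therefore meets in a nonempty open
  set.\<close>

lemma measure_torus_open_pos:
  assumes "open U" "(0 :: real^'n) \<in> U"
  shows "0 < measure torus (U \<inter> unit_cell)"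
proof -
  have "0 \<in> closure (box 0 (1 :: real^'n))"
  proof -
    have "box 0 (1::real^'n) \<noteq> {}" by (simp add: interval_ne_empty_cart)
    then show ?thesis by (simp add: closure_box mem_box_cart)
  qed
  then have "U \<inter> box 0 1 \<noteq> {}"
    using open_Int_closure_eq_empty[OF assms(1)] assms(2) by blast
  moreover have "open (U \<inter> box 0 1)" using assms by auto
  ultimately have "\<not> negligible (U \<inter> box 0 1)" by (rule open_not_negligible[rotated])
  moreover have "U \<inter> box 0 1 \<subseteq> U \<inter> unit_cell" by (auto simp: unit_cell_def mem_box_cart less_imp_le)
  ultimately have "\<not> negligible (U \<inter> unit_cell)" using negligible_subset by blast
  moreover have meas: "U \<inter> unit_cell \<in> sets lborel" using assms by auto
  ultimately have "emeasure lborel (U \<inter> unit_cell) \<noteq> 0"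
    using null_sets_completionI by (auto simp: negligible_iff_null_sets)
  moreover have "emeasure torus (U \<inter> unit_cell) = emeasure lborel (U \<inter> unit_cell)"
    by (simp add: torus_def emeasure_restrict_space)
  ultimately show ?thesis
    by (metis torus.emeasure_eq_measure ennreal_eq_0_iff not_le)
qed

text \<open>Only the region where \<open>bump\<close> exceeds \<open>r\<close> is kept. The
  geometric rate \<open>r ^ n\<close> is later compared with a smaller one away from the
  peak.\<close>

lemma integral_cos_kernel_ge:
  assumes "0 \<le> r" 
  shows "r ^ n * measure torus ({x :: real^'n. r < bump x} \<inter> unit_cell) \<le> integral\<^sup>L torus (cos_kernel n :: real^'n \<Rightarrow> real)"
proof -
  have "open {x :: real^'n. r < bump x}"
    using open_Collect_less[OF continuous_on_const test_function_continuous[OF test_function_bump]] .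
  then have meas: "{x :: real^'n. r < bump x} \<inter> unit_cell \<in> sets torus"
    by (simp add: torus_def sets_restrict_space_iff)
  then have "r ^ n * measure torus ({x :: real^'n. r < bump x} \<inter> unit_cell)
     = (\<integral>x. r ^ n * indicator ({x :: real^'n. r < bump x} \<inter> unit_cell) x \<partial>torus)"
    using sets.sets_into_space by (simp add: Int_absorb2)
  also have "\<dots> \<le> integral\<^sup>L torus (cos_kernel n :: real^'n \<Rightarrow> real)"
  proof (rule integral_mono')
    show "integrable torus (cos_kernel n :: real^'n \<Rightarrow> real)" by (rule integrable_test_function[OF test_function_cos_kernel])
    show "r ^ n * indicator ({x :: real^'n. r < bump x} \<inter> unit_cell) x \<le> cos_kernel n x" for x
      using assms by (auto simp: indicator_def cos_kernel_def bump_bounds intro: power_mono)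
  qed (rule cos_kernel_nonneg)
  finally show ?thesis .
qed

lemma integral_cos_kernel_pos: "0 < integral\<^sup>L torus (cos_kernel n :: real^'n \<Rightarrow> real)"
proof -
  have "open {x :: real^'n. 1/2 < bump x}"
    using open_Collect_less[OF continuous_on_const test_function_continuous[OF test_function_bump]] .
  then have "0 < measure torus ({x :: real^'n. 1/2 < bump x} \<inter> unit_cell)"
    by (intro measure_torus_open_pos) (auto simp: bump_0)
  then have "0 < (1/2) ^ n * measure torus ({x :: real^'n. 1/2 < bump x} \<inter> unit_cell)" by simp
  also have "\<dots> \<le> integral\<^sup>L torus (cos_kernel n :: real^'n \<Rightarrow> real)"
    by (rule integral_cos_kernel_ge) simp
  finally show ?thesis .
qed

text \<open>Where \<open>A\<close> is far from \<open>A 0\<close>, \<open>bump\<close> is at most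
  some \<open>q < 1\<close>, while the normalizing integral decays no faster than a multiple of
  \<open>r ^ n\<close> with \<open>q < r < 1\<close>. The far region thus contributes a multiple of
  \<open>(q / r) ^ n\<close>.\<close>

lemma cos_kernel_approximates_identity:
  fixes A :: "real^'n \<Rightarrow> real"
  assumes A: "continuous_on UNIV A" "periodic A"
  shows "(\<lambda>n. (\<integral>z. cos_kernel n z * A z \<partial>torus) / integral\<^sup>L torus (cos_kernel n :: real^'n \<Rightarrow> real)) \<longlonglongrightarrow> A 0"
proof (rule LIMSEQ_I)
  fix e :: real assume e: "e > 0"
  let ?Z = "\<lambda>n. integral\<^sup>L torus (cos_kernel n :: real^'n \<Rightarrow> real)"
  have Am: "A \<in> borel_measurable borel" using A(1) by (rule borel_measurable_continuous_onI)
  have cbump: "continuous_on S bump" for S :: "(real^'n) set"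
    by (rule continuous_on_subset[OF test_function_continuous[OF test_function_bump]]) simp
  have "bounded ((\<lambda>z. A z - A 0) ` cbox 0 1)"
    by (intro compact_imp_bounded compact_continuous_image continuous_intros continuous_on_subset[OF A(1)]) auto
  then obtain B where B: "B > 0" "\<And>z. z \<in> cbox 0 1 \<Longrightarrow> \<bar>A z - A 0\<bar> \<le> B" by (auto simp: bounded_pos)
  \<comment> \<open>Cut out by the values of \<open>A\<close> and not by the distance from 0, so
    that the other corners of the cube, where periodicity gives the value \<open>A 0\<close> again,
    are excluded automatically.\<close>
  define S where "S = {z \<in> cbox 0 1. e / 2 \<le> \<bar>A z - A 0\<bar>}"
  have "closed {z. e / 2 \<le> \<bar>A z - A 0\<bar>}"
    by (intro closed_Collect_le continuous_intros A(1))
  moreover have "S = cbox 0 1 \<inter> {z. e / 2 \<le> \<bar>A z - A 0\<bar>}" by (auto simp: S_def)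
  ultimately have "compact S" by (simp add: compact_Int_closed)
  have "\<exists>q. 0 \<le> q \<and> q < 1 \<and> (\<forall>z\<in>S. bump z \<le> q)"
  proof (cases "S = {}")
    case False
    then obtain z where z: "z \<in> S" "\<And>y. y \<in> S \<Longrightarrow> bump y \<le> bump z"
      using continuous_attains_sup[OF \<open>compact S\<close> _ cbump] by blast
    have "bump z \<noteq> 1"
    proof
      assume "bump z = 1"
      then have "A (0 + z) = A 0" by (intro periodic_lattice A bump_eq_1_imp_lattice)
      then show False using z(1) e by (simp add: S_def)
    qed
    then show ?thesis using z(2) bump_bounds[of z] by (intro exI[of _ "bump z"]) auto
  qed (auto intro: exI[of _ 0])
  then obtain q where q: "0 \<le> q" "q < 1" "\<And>z. z \<in> S \<Longrightarrow> bump z \<le> q" by blast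
  \<comment> \<open>Any number strictly between \<open>q\<close> and 1 would serve.\<close>
  define r where "r = (1 + q) / 2"
  have r: "0 < r" "q < r" "r < 1" using q by (auto simp: r_def)
  define \<mu> where "\<mu> = measure torus ({x :: real^'n. r < bump x} \<inter> unit_cell)"
  have "open {x :: real^'n. r < bump x}"
    by (rule open_Collect_less[OF continuous_on_const cbump])
  then have \<mu>: "\<mu> > 0" unfolding \<mu>_def using r by (intro measure_torus_open_pos) (auto simp: bump_0)
  have "(\<lambda>n. B / \<mu> * (q / r) ^ n) \<longlonglongrightarrow> B / \<mu> * 0"
    using q r by (intro tendsto_intros LIMSEQ_power_zero) auto
  then have "\<forall>\<^sub>F n in sequentially. B / \<mu> * (q / r) ^ n < e / 2"
    using e by (intro order_tendstoD(2)[where a="e/2"]) auto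
  then obtain N where N: "\<And>n. n \<ge> N \<Longrightarrow> B / \<mu> * (q / r) ^ n < e / 2"
    by (auto simp: eventually_sequentially)
  have "norm ((\<integral>z. cos_kernel n z * A z \<partial>torus) / ?Z n - A 0) < e" if "n \<ge> N" for n
  proof -
    have Z: "?Z n > 0" by (rule integral_cos_kernel_pos)
    have ik: "integrable torus (cos_kernel n :: real^'n \<Rightarrow> real)"
      by (rule integrable_test_function[OF test_function_cos_kernel])
    have bA: "\<bar>A z\<bar> \<le> B + \<bar>A 0\<bar>" for z
    proof -
      obtain y where y: "y \<in> lattice" "z + y \<in> unit_cell" using ex1_lattice_shift[of z] by auto
      have "A (z + y) = A z" by (rule periodic_lattice[OF A(2) y(1)])
      then show ?thesis using B(2)[of "z + y"] y(2) unit_cell_subset by fastforce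
    qed
    have iA: "integrable torus (\<lambda>z. cos_kernel n z * A z)"
      by (rule integrable_torus_mult_bounded[OF ik Am bA])
    have "(\<integral>z. cos_kernel n z * A z \<partial>torus) - A 0 * ?Z n = (\<integral>z. cos_kernel n z * (A z - A 0) \<partial>torus)"
      using iA ik by (simp add: right_diff_distrib)
    then have "\<bar>(\<integral>z. cos_kernel n z * A z \<partial>torus) - A 0 * ?Z n\<bar> \<le> (\<integral>z. \<bar>cos_kernel n z * (A z - A 0)\<bar> \<partial>torus)"
      by (simp add: integral_abs_bound)
    also have "\<dots> \<le> integral\<^sup>L torus (\<lambda>z::real^'n. e / 2 * cos_kernel n z + B * q ^ n)"
    proof (rule integral_mono)
      show "integrable torus (\<lambda>z. \<bar>cos_kernel n z * (A z - A 0)\<bar>)"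
        using iA ik by (simp add: right_diff_distrib)
      show "integrable torus (\<lambda>z::real^'n. e / 2 * cos_kernel n z + B * q ^ n)" using ik by simp
      fix z :: "real^'n" assume z: "z \<in> space torus"
      then have zc: "z \<in> cbox 0 1" using unit_cell_subset by auto
      show "\<bar>cos_kernel n z * (A z - A 0)\<bar> \<le> e / 2 * cos_kernel n z + B * q ^ n"
      proof (cases "z \<in> S")
        case True
        then have "cos_kernel n z \<le> q ^ n" unfolding cos_kernel_def by (intro power_mono q bump_bounds)
        then have "cos_kernel n z * \<bar>A z - A 0\<bar> \<le> q ^ n * B"
          using B(2)[OF zc] q by (intro mult_mono) auto
        moreover have "0 \<le> e / 2 * cos_kernel n z" using e cos_kernel_nonneg[of n z] by simp
        ultimately show ?thesis by (simp add: abs_mult cos_kernel_nonneg mult.commute)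
      next
        case False
        then have "cos_kernel n z * \<bar>A z - A 0\<bar> \<le> cos_kernel n z * (e / 2)"
          using zc by (intro mult_left_mono cos_kernel_nonneg) (auto simp: S_def)
        moreover have "0 \<le> B * q ^ n" using B q by simp
        ultimately show ?thesis by (simp add: abs_mult cos_kernel_nonneg mult.commute)
      qed
    qed
    also have "\<dots> = e / 2 * ?Z n + B * q ^ n * measure torus (unit_cell :: (real^'n) set)"
      using ik by simp
    also have "\<dots> \<le> e / 2 * ?Z n + B * q ^ n * 1"
      using B q measure_torus_le by (intro add_left_mono mult_left_mono) auto
    finally have 1: "\<bar>(\<integral>z. cos_kernel n z * A z \<partial>torus) - A 0 * ?Z n\<bar> \<le> e / 2 * ?Z n + B * q ^ n" by simp
    have "r ^ n * \<mu> \<le> ?Z n" unfolding \<mu>_def using r by (intro integral_cos_kernel_ge) simp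
    then have "B * q ^ n / ?Z n \<le> B * q ^ n / (r ^ n * \<mu>)"
      using B q r \<mu> by (intro divide_left_mono) (auto intro: mult_pos_pos Z)
    also have "\<dots> = B / \<mu> * (q / r) ^ n" by (simp add: power_divide)
    finally have 2: "B * q ^ n / ?Z n < e / 2" using N[OF that] by linarith
    have "\<bar>(\<integral>z. cos_kernel n z * A z \<partial>torus) / ?Z n - A 0\<bar>
        = \<bar>(\<integral>z. cos_kernel n z * A z \<partial>torus) - A 0 * ?Z n\<bar> / ?Z n"
      using Z by (simp add: field_simps)
    also have "\<dots> \<le> (e / 2 * ?Z n + B * q ^ n) / ?Z n"
      using 1 Z by (intro divide_right_mono) auto
    also have "\<dots> = e / 2 + B * q ^ n / ?Z n" using Z by (simp add: add_divide_distrib)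
    finally show ?thesis using 2 unfolding real_norm_def by linarith
  qed
  then show "\<exists>N. \<forall>n\<ge>N. norm ((\<integral>z. cos_kernel n z * A z \<partial>torus) / ?Z n - A 0) < e" by blast
qed

section \<open>Convolution with separable kernels\<close>

definition conv :: "(real^'n \<Rightarrow> real) \<Rightarrow> (real^'n \<Rightarrow> real) \<Rightarrow> real^'n \<Rightarrow> real" where
  "conv m \<phi> x = (\<integral>y. m y * \<phi> (x - y) \<partial>torus)"

text \<open>Finite-rank kernels. Building the sums two at a time gives an induction in which
  smoothness and differentiation under the integral are proved together.\<close>

inductive separable :: "(real^'n \<Rightarrow> real^'n \<Rightarrow> real) \<Rightarrow> bool" where
  product: "test_function a \<Longrightarrow> test_function b \<Longrightarrow> separable (\<lambda>x y. a x * b y)"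
| add: "separable \<kappa> \<Longrightarrow> separable \<kappa>' \<Longrightarrow> separable (\<lambda>x y. \<kappa> x y + \<kappa>' x y)"

lemma separable_mult:
  assumes "separable \<kappa>" "separable \<kappa>'"
  shows "separable (\<lambda>x y. \<kappa> x y * \<kappa>' x y)"
  using assms(1)
proof induction
  case (product a b)
  from assms(2) show ?case
  proof induction
    case (product a' b')
    then show ?case
      using separable.product[OF test_function_mult[OF \<open>test_function a\<close> product(1)]
          test_function_mult[OF \<open>test_function b\<close> product(2)]]
      by (simp add: mult.assoc mult.left_commute)
  next
    case (add \<kappa> \<kappa>')
    then show ?case using separable.add[OF add.IH] by (simp add: distrib_left)
  qed
next
  case (add \<kappa> \<kappa>')
  then show ?case using separable.add[OF add.IH] by (simp add: distrib_right)
qed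

lemma separable_const: "separable (\<lambda>x y. c)"
  using separable.product[OF test_function_const[of c] test_function_const[of 1]] by simp

text \<open>The addition formula for the cosine splits each factor, and products of separable
  kernels expand into separable ones.\<close>

lemma separable_cos_kernel: "separable (\<lambda>(x::real^'n) y. cos_kernel n (x - y))"
proof -
  have "separable (\<lambda>(x::real^'n) y. (1 + cos (2 * pi * (x - y) $ i)) / 2)" for i
  proof -
    have *: "(1 + cos (2 * pi * (x - y) $ i)) / 2
       = 1/2 + (cos (2 * pi * x $ i) * cos (2 * pi * y $ i) + sin (2 * pi * x $ i) * sin (2 * pi * y $ i)) * (1/2)"
      for x y :: "real^'n"
      by (simp add: right_diff_distrib cos_diff)
    show ?thesis unfolding *
      by (intro separable.add separable_mult separable_const separable.product test_function_trig)
  qed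
  note factor = this
  have "separable (\<lambda>(x::real^'n) y. \<Prod>i\<in>S. (1 + cos (2 * pi * (x - y) $ i)) / 2)" if "finite S" for S
    using that
  proof induction
    case (insert i S)
    then show ?case using separable_mult[OF factor[of i] insert.IH] by simp
  qed (simp add: separable_const)
  then have "separable (\<lambda>(x::real^'n) y. bump (x - y))" by (simp add: bump_def)
  then show ?thesis unfolding cos_kernel_def
    by (induction n) (auto intro: separable_const separable_mult)
qed

lemma partial_add:
  assumes "test_function \<phi>" "test_function \<psi>"
  shows "partial i (\<lambda>x. \<phi> x + \<psi> x) x = partial i \<phi> x + partial i \<psi> x"
  by (subst partial_eqI[OF has_derivative_add[OF assms[THEN test_function_differentiable]]])
    (simp add: partial_def)

lemma partial_mult_const:
  assumes "test_function \<phi>"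
  shows "partial i (\<lambda>x. \<phi> x * c) x = partial i \<phi> x * c"
  by (subst partial_eqI[OF has_derivative_mult_left[OF assms[THEN test_function_differentiable]]])
    (simp add: partial_def)

lemma separable_test_functions:
  "separable \<kappa> \<Longrightarrow> test_function (\<lambda>x. \<kappa> x y) \<and> test_function (\<kappa> x)"
  by (induction rule: separable.induct)
    (auto intro: test_function_add test_function_mult test_function_const)

text \<open>For a product \<open>a x * b y\<close> the integral over \<open>y\<close> is a mere
  coefficient of \<open>a\<close>. The integrability clause is carried along so that the integral of
  a sum of derivatives can be split in the case \<open>add\<close>.\<close>

lemma separable_integral:
  assumes m: "integrable torus m" and "separable \<kappa>"
  shows "(\<forall>x. integrable torus (\<lambda>y. m y * partial i (\<lambda>x. \<kappa> x y) x)) \<and>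
    test_function (\<lambda>x. \<integral>y. m y * \<kappa> x y \<partial>torus) \<and>
    (\<forall>x. partial i (\<lambda>x. \<integral>y. m y * \<kappa> x y \<partial>torus) x = (\<integral>y. m y * partial i (\<lambda>x. \<kappa> x y) x \<partial>torus))"
  using assms(2)
proof induction
  case (product a b)
  let ?c = "\<integral>y. m y * b y \<partial>torus"
  have scale: "m y * (s * b y) = s * (m y * b y)" for s y by (rule mult.left_commute)
  have eq: "(\<integral>y. m y * (a x * b y) \<partial>torus) = a x * ?c" for x
    by (simp add: scale)
  have "test_function (\<lambda>x. a x * ?c)" using product by (intro test_function_mult test_function_const)
  moreover have "integrable torus (\<lambda>y. m y * b y)"
    by (rule integrable_mult_test_function[OF m product(2)])
  ultimately show ?case
    unfolding eq using product by (simp add: partial_mult_const scale)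
next
  case (add \<kappa> \<kappa>')
  have i: "integrable torus (\<lambda>y. m y * \<kappa> x y)" "integrable torus (\<lambda>y. m y * \<kappa>' x y)" for x
    using add.hyps separable_test_functions integrable_mult_test_function[OF m] by blast+
  have *: "(\<integral>y. m y * (\<kappa> x y + \<kappa>' x y) \<partial>torus) = (\<integral>y. m y * \<kappa> x y \<partial>torus) + (\<integral>y. m y * \<kappa>' x y \<partial>torus)" for x
    using i by (simp add: distrib_left)
  have "partial i (\<lambda>x. \<kappa> x y + \<kappa>' x y) x = partial i (\<lambda>x. \<kappa> x y) x + partial i (\<lambda>x. \<kappa>' x y) x" for x y
    using add.hyps separable_test_functions by (intro partial_add) blast+
  then show ?case unfolding * using add.IH by (simp add: distrib_left test_function_add partial_add)
qed

lemma test_function_conv_cos_kernel: "integrable torus m \<Longrightarrow> test_function (conv m (cos_kernel n))"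
  using separable_integral[OF _ separable_cos_kernel] by (auto simp: conv_def[abs_def])

text \<open>The derivative falls on the kernel. Reflection turns it into a derivative in
  \<open>y\<close> with a minus sign, and the weak derivative of \<open>m\<close> supplies the
  second minus sign.\<close>

lemma partial_conv_cos_kernel:
  assumes "weak_partial i m g"
  shows "partial i (conv m (cos_kernel n)) x = conv g (cos_kernel n) x"
proof -
  have m: "integrable torus m" using assms by (auto simp: weak_partial_def Lp_1_iff)
  have reflection: "partial i (\<lambda>y. cos_kernel n (x - y)) y = - partial i (\<lambda>x. cos_kernel n (x - y)) x" for y
  proof -
    let ?D = "frechet_derivative (cos_kernel n) (at (x - y))"
    have d: "(cos_kernel n has_derivative ?D) (at (x - y))"
      by (rule test_function_differentiable[OF test_function_cos_kernel])
    have "((\<lambda>x. cos_kernel n (x - y)) has_derivative (\<lambda>v. ?D v)) (at x)"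
      by (rule has_derivative_compose[of "\<lambda>x. x - y" "\<lambda>v. v" x UNIV, OF _ d]) (auto intro!: derivative_eq_intros)
    moreover have "((\<lambda>y. cos_kernel n (x - y)) has_derivative (\<lambda>v. ?D (- v))) (at y)"
      by (rule has_derivative_compose[of "\<lambda>y. x - y" "\<lambda>v. - v" y UNIV, OF _ d]) (auto intro!: derivative_eq_intros)
    moreover have "?D (- axis i 1) = - ?D (axis i 1)"
      using has_derivative_linear[OF d] by (rule linear_neg)
    ultimately show ?thesis by (simp add: partial_eqI)
  qed
  have "partial i (conv m (cos_kernel n)) x = (\<integral>y. m y * partial i (\<lambda>x. cos_kernel n (x - y)) x \<partial>torus)"
    unfolding conv_def[abs_def] using separable_integral[OF m separable_cos_kernel] by blast
  also have "\<dots> = - (\<integral>y. m y * partial i (\<lambda>y. cos_kernel n (x - y)) y \<partial>torus)"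
    by (simp add: reflection)
  also have "\<dots> = (\<integral>y. g y * cos_kernel n (x - y) \<partial>torus)"
  proof -
    have "test_function (\<lambda>y. cos_kernel n (x - y))"
      using separable_test_functions[OF separable_cos_kernel] by blast
    then have "(\<integral>y. m y * partial i (\<lambda>y. cos_kernel n (x - y)) y \<partial>torus) = - (\<integral>y. g y * cos_kernel n (x - y) \<partial>torus)"
      using assms unfolding weak_partial_def by blast
    then show ?thesis by simp
  qed
  finally show ?thesis by (simp add: conv_def)
qed

text \<open>Evenness of the kernel turns the convolution into an average of translates of \<open>m\<close>.\<close>

lemma conv_eq_shift:
  assumes "m \<in> Lp 1"
  shows "conv m (cos_kernel n) x = (\<integral>z. m (x + z) * cos_kernel n z \<partial>torus)"
proof -
  have per: "periodic (\<lambda>y. m y * cos_kernel n (x - y))" "(\<lambda>y. m y * cos_kernel n (x - y)) \<in> borel_measurable borel"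
  proof -
    have "test_function (\<lambda>y. cos_kernel n (x - y))"
      using separable_test_functions[OF separable_cos_kernel] by blast
    then have "periodic (\<lambda>y. cos_kernel n (x - y))" "(\<lambda>y. cos_kernel n (x - y)) \<in> borel_measurable borel"
      using test_function_measurable by (auto simp only: test_function_def)
    then show "periodic (\<lambda>y. m y * cos_kernel n (x - y))" "(\<lambda>y. m y * cos_kernel n (x - y)) \<in> borel_measurable borel"
      using assms by (auto simp: Lp_1_iff periodic_def)
  qed
  have "conv m (cos_kernel n) x = (\<integral>y. m (y + x) * cos_kernel n (x - (y + x)) \<partial>torus)"
    unfolding conv_def using integral_torus_shift[OF per(2,1), of x] by simp
  then show ?thesis by (simp add: cos_kernel_def bump_uminus add.commute)
qed

text \<open>Fubini, with the convolution written as an average of translates. Integrability on the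
  product space holds because all translates of \<open>m\<close> have the same L1 norm and the
  kernel is at most 1.\<close>

lemma integral_mult_conv:
  fixes w m :: "real^'n \<Rightarrow> real"
  assumes w: "w \<in> Lp 1" and m: "m \<in> Lp 1"
  shows "(\<integral>x. w x * conv m (cos_kernel n) x \<partial>torus) = (\<integral>z. cos_kernel n z * corr w m z \<partial>torus)"
proof -
  interpret P: pair_sigma_finite "torus :: (real^'n) measure" "torus :: (real^'n) measure" ..
  have [measurable]: "w \<in> borel_measurable borel" "m \<in> borel_measurable borel"
    "cos_kernel n \<in> borel_measurable (borel :: (real^'n) measure)"
    using w m by (auto simp: Lp_1_iff intro: test_function_measurable test_function_cos_kernel)
  have id: "(\<lambda>x. x) \<in> measurable torus (borel :: (real^'n) measure)"
    by (rule borel_measurable_torus) simp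
  have [measurable]: "fst \<in> measurable (torus \<Otimes>\<^sub>M torus) (borel :: (real^'n) measure)"
    "snd \<in> measurable (torus \<Otimes>\<^sub>M torus) (borel :: (real^'n) measure)"
    using measurable_compose[OF measurable_fst id] measurable_compose[OF measurable_snd id] by auto
  have mm: "(\<lambda>p. w (fst p) * m (fst p + snd p)) \<in> borel_measurable (torus \<Otimes>\<^sub>M torus)" by measurable
  have mshift: "integrable torus (\<lambda>z. m (x + z))" "(\<integral>z. \<bar>m (x + z)\<bar> \<partial>torus) = (\<integral>z. \<bar>m z\<bar> \<partial>torus)" for x
    using integrable_torus_shift[of m x] integral_torus_shift[of "\<lambda>z. \<bar>m z\<bar>" x] m
    by (auto simp: Lp_1_iff periodic_def add.commute)
  have "integrable (torus \<Otimes>\<^sub>M torus) (\<lambda>p. w (fst p) * m (fst p + snd p))"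
    by (rule P.Fubini_integrable[OF mm])
      (use w mshift in \<open>simp_all add: abs_mult Lp_1_iff\<close>)
  then have "integrable (torus \<Otimes>\<^sub>M torus) (\<lambda>p. w (fst p) * m (fst p + snd p) * cos_kernel n (snd p))"
    by (rule Bochner_Integration.integrable_bound)
       (measurable, simp add: abs_mult cos_kernel_nonneg mult_left_le cos_kernel_le_1)
  then have "(\<integral>z. (\<integral>x. w x * m (x + z) * cos_kernel n z \<partial>torus) \<partial>torus) = (\<integral>x. (\<integral>z. w x * m (x + z) * cos_kernel n z \<partial>torus) \<partial>torus)"
    by (intro P.Fubini_integral) (simp add: case_prod_unfold)
  moreover have "(\<integral>x. w x * m (x + z) * cos_kernel n z \<partial>torus) = cos_kernel n z * corr w m z" for z
    by (simp add: corr_def mult.commute)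
  moreover have "(\<integral>z. w x * m (x + z) * cos_kernel n z \<partial>torus) = w x * conv m (cos_kernel n) x" for x
    by (simp add: conv_eq_shift[OF m] mult.assoc)
  ultimately show ?thesis by (simp only:)
qed

section \<open>Limits of mollifications and their consequences\<close>

lemma periodic_corr: "periodic m \<Longrightarrow> periodic (corr w m)"
  by (auto simp: corr_def periodic_def add.assoc[symmetric])

lemma mollification_tendsto:
  fixes w m :: "real^'n \<Rightarrow> real"
  assumes "w \<in> Lp 1" "m \<in> Lp 1" "continuous_on UNIV (corr w m)"
  shows "(\<lambda>n. (\<integral>x. w x * conv m (cos_kernel n) x \<partial>torus) / integral\<^sup>L torus (cos_kernel n :: real^'n \<Rightarrow> real))
    \<longlonglongrightarrow> (\<integral>x. w x * m x \<partial>torus)"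
proof -
  have "periodic (corr w m)" using assms(2) by (auto simp: Lp_1_iff intro: periodic_corr)
  from cos_kernel_approximates_identity[OF assms(3) this] show ?thesis
    by (simp add: integral_mult_conv[OF assms(1,2)] corr_def)
qed

text \<open>Mollifications of the sign of \<open>g\<close> are test functions, and their normalized
  integrals against \<open>g\<close> tend to the integral of \<open>\<bar>g\<bar>\<close>.
  Boundedness of the sign is what allows \<open>g\<close> to be merely integrable.\<close>

lemma fundamental_lemma:
  fixes g :: "real^'n \<Rightarrow> real"
  assumes g: "g \<in> Lp 1" and test: "\<And>\<phi>. test_function \<phi> \<Longrightarrow> (\<integral>x. g x * \<phi> x \<partial>torus) = 0"
  shows "AE x in torus. g x = 0"
proof -
  have g': "g \<in> borel_measurable borel" "integrable torus g" "periodic g" using g by (auto simp: Lp_1_iff)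
  let ?s = "\<lambda>x. sgn (g x)"
  have s: "?s \<in> borel_measurable borel" "\<And>x. \<bar>?s x\<bar> \<le> 1" using g' by (auto simp: sgn_if)
  then have sL: "?s \<in> Lp 1" using g' integrable_torus_bounded[OF s] by (auto simp: Lp_1_iff periodic_def)
  have "(\<lambda>n. 0) \<longlonglongrightarrow> (\<integral>x. g x * ?s x \<partial>torus)"
    using mollification_tendsto[OF g sL continuous_on_corr_bounded[OF g s]] sL
    by (simp add: test test_function_conv_cos_kernel Lp_1_iff)
  then have "(\<integral>x. \<bar>g x\<bar> \<partial>torus) = 0"
    by (simp add: LIMSEQ_const_iff abs_sgn[symmetric] mult.commute)
  then have "AE x in torus. \<bar>g x\<bar> = 0"
    using g' by (subst (asm) integral_nonneg_eq_0_iff_AE) auto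
  then show ?thesis by simp
qed

text \<open>A mollification of \<open>m\<close> is an admissible test function for \<open>w\<close>,
  and its derivative is the mollification of \<open>gm\<close>. Both sides of the resulting identity
  converge by \<open>corr_tendsto_Lp_2\<close>.\<close>

lemma integration_by_parts_Lp_2:
  fixes w m :: "real^'n \<Rightarrow> real"
  assumes w: "weak_partial i w gw" "w \<in> Lp 2" "gw \<in> Lp 2"
    and m: "weak_partial i m gm" "m \<in> Lp 2" "gm \<in> Lp 2"
  shows "(\<integral>x. w x * gm x \<partial>torus) = - (\<integral>x. gw x * m x \<partial>torus)"
proof -
  note L1 = w(2,3)[THEN Lp_2_subset_1] m(2,3)[THEN Lp_2_subset_1]
  have "(\<integral>x. w x * conv gm (cos_kernel n) x \<partial>torus) = - (\<integral>x. gw x * conv m (cos_kernel n) x \<partial>torus)" for n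
  proof -
    have "conv gm (cos_kernel n) = partial i (conv m (cos_kernel n))"
      by (rule ext) (simp add: partial_conv_cos_kernel[OF m(1)])
    moreover have "test_function (conv m (cos_kernel n))"
      using L1 by (intro test_function_conv_cos_kernel) (simp add: Lp_1_iff)
    ultimately show ?thesis using w(1) by (simp add: weak_partial_def)
  qed
  then have "(\<lambda>n. - ((\<integral>x. gw x * conv m (cos_kernel n) x \<partial>torus) / integral\<^sup>L torus (cos_kernel n :: real^'n \<Rightarrow> real)))
     \<longlonglongrightarrow> (\<integral>x. w x * gm x \<partial>torus)"
    using mollification_tendsto[OF L1(1,4) continuous_on_corr_Lp_2[OF w(2) m(3)]] by simp
  moreover have "(\<lambda>n. - ((\<integral>x. gw x * conv m (cos_kernel n) x \<partial>torus) / integral\<^sup>L torus (cos_kernel n :: real^'n \<Rightarrow> real)))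
     \<longlonglongrightarrow> - (\<integral>x. gw x * m x \<partial>torus)"
    by (intro tendsto_minus mollification_tendsto[OF L1(2,3) continuous_on_corr_Lp_2[OF w(3) m(2)]])
  ultimately show ?thesis by (rule LIMSEQ_unique)
qed

section \<open>Sobolev spaces\<close>

text \<open>The difference of two candidates integrates to 0 against every test function. Hence the
  choice made in \<open>wd\<close> is immaterial up to null sets.\<close>

lemma weak_partial_unique:
  assumes "weak_partial i u g" "weak_partial i u h"
  shows "AE x in torus. g x = h x"
proof -
  have "AE x in torus. g x - h x = 0"
  proof (rule fundamental_lemma)
    show "(\<lambda>x. g x - h x) \<in> Lp 1" using assms by (auto simp: weak_partial_def Lp_1_iff periodic_def)
    fix \<phi> :: "real^'a \<Rightarrow> real" assume \<phi>: "test_function \<phi>"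
    have "integrable torus (\<lambda>x. g x * \<phi> x)" "integrable torus (\<lambda>x. h x * \<phi> x)"
      using assms \<phi> by (auto simp: weak_partial_def Lp_1_iff intro: integrable_mult_test_function)
    then show "(\<integral>x. (g x - h x) * \<phi> x \<partial>torus) = 0"
      using assms \<phi> by (simp add: weak_partial_def left_diff_distrib)
  qed
  then show ?thesis by simp
qed

lemma weak_partial_wd:
  assumes "u \<in> H1"
  shows "weak_partial i u (wd i u)"
proof -
  have "\<exists>g. weak_partial i u g" using assms by (simp add: numeral_eq_Suc) blast
  then show ?thesis unfolding wd_def by (rule someI_ex)
qed

lemma Lp_2_AE_cong:
  assumes g: "g \<in> Lp 2" and h: "h \<in> Lp 1" and ae: "AE x in torus. g x = h x"
  shows "h \<in> Lp 2"
proof -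
  have m: "h \<in> borel_measurable borel" "g \<in> borel_measurable borel" using g h by (auto simp: Lp_1_iff Lp_2_iff)
  have "integrable torus (\<lambda>x. (g x)\<^sup>2) \<longleftrightarrow> integrable torus (\<lambda>x. (h x)\<^sup>2)"
    using ae m by (intro integrable_cong_AE) (auto intro: borel_measurable_torus)
  then show ?thesis using g h by (simp add: Lp_1_iff Lp_2_iff)
qed

lemma H1_iff: "u \<in> H1 \<longleftrightarrow> u \<in> Lp 2 \<and> (\<forall>i. \<exists>g\<in>Lp 2. weak_partial i u g)"
  by simp

text \<open>The choice in \<open>wd\<close> promises only integrability; square integrability is
  carried over from the \<open>H1\<close> witness, which agrees with it almost everywhere.\<close>

lemma wd_Lp_2:
  assumes "u \<in> H1"
  shows "wd i u \<in> Lp 2"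
proof -
  obtain g where g: "g \<in> Lp 2" "weak_partial i u g" using assms H1_iff by blast
  have "weak_partial i u (wd i u)" by (rule weak_partial_wd[OF assms])
  then show ?thesis
    using weak_partial_unique[OF g(2)] g(1) by (auto intro!: Lp_2_AE_cong[of g] simp: weak_partial_def)
qed

lemma Lp_2_linear:
  assumes "u \<in> Lp 2" "v \<in> Lp 2"
  shows "(\<lambda>x. a * u x + b * v x) \<in> Lp 2"
proof -
  have "integrable torus (\<lambda>x. a * a * (u x * u x) + b * b * (v x * v x) + 2 * a * b * (u x * v x))"
    by (intro Bochner_Integration.integrable_add integrable_mult_right integrable_mult_Lp_2 assms)
  then have "integrable torus (\<lambda>x. (a * u x + b * v x)\<^sup>2)"
    by (simp add: power2_eq_square algebra_simps)
  then show ?thesis using assms by (auto simp: Lp_2_iff periodic_def)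
qed

lemma Lp_1_linear:
  "u \<in> Lp 1 \<Longrightarrow> v \<in> Lp 1 \<Longrightarrow> (\<lambda>x. a * u x + b * v x) \<in> Lp 1"
  by (auto simp: Lp_1_iff periodic_def)

lemma weak_partial_linear:
  assumes "weak_partial i u g" "weak_partial i v h"
  shows "weak_partial i (\<lambda>x. a * u x + b * v x) (\<lambda>x. a * g x + b * h x)"
proof -
  have "u \<in> Lp 1" "g \<in> Lp 1" "v \<in> Lp 1" "h \<in> Lp 1" using assms by (auto simp: weak_partial_def)
  moreover have "(\<integral>x. (a * u x + b * v x) * partial i \<phi> x \<partial>torus) = - (\<integral>x. (a * g x + b * h x) * \<phi> x \<partial>torus)"
    if \<phi>: "test_function \<phi>" for \<phi>
  proof -
    have "integrable torus (\<lambda>x. u x * partial i \<phi> x)" "integrable torus (\<lambda>x. v x * partial i \<phi> x)"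
      "integrable torus (\<lambda>x. g x * \<phi> x)" "integrable torus (\<lambda>x. h x * \<phi> x)"
      using assms \<phi> test_function_partial[OF \<phi>]
      by (auto simp: weak_partial_def Lp_1_iff intro!: integrable_mult_test_function)
    moreover have "(\<integral>x. u x * partial i \<phi> x \<partial>torus) = - (\<integral>x. g x * \<phi> x \<partial>torus)"
       "(\<integral>x. v x * partial i \<phi> x \<partial>torus) = - (\<integral>x. h x * \<phi> x \<partial>torus)"
      using assms \<phi> by (auto simp: weak_partial_def)
    ultimately show ?thesis by (simp add: distrib_right mult.assoc)
  qed
  ultimately show ?thesis by (auto simp: weak_partial_def intro!: Lp_1_linear)
qed

lemma H1_linear:
  assumes "u \<in> H1" "v \<in> H1"
  shows "(\<lambda>x. a * u x + b * v x) \<in> H1"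
  unfolding H1_iff
proof (intro conjI allI)
  show "(\<lambda>x. a * u x + b * v x) \<in> Lp 2" using assms unfolding H1_iff by (intro Lp_2_linear) auto
  show "\<exists>g\<in>Lp 2. weak_partial i (\<lambda>x. a * u x + b * v x) g" for i
    using weak_partial_linear[OF assms[THEN weak_partial_wd]] Lp_2_linear[OF assms[THEN wd_Lp_2]] by blast
qed

lemma inner_L2_linear_right:
  assumes "w \<in> Lp 2" "u \<in> Lp 2" "v \<in> Lp 2"
  shows "inner_L2 w (\<lambda>x. a * u x + b * v x) = a * inner_L2 w u + b * inner_L2 w v"
  using integrable_mult_Lp_2[OF assms(1,2)] integrable_mult_Lp_2[OF assms(1,3)]
  by (simp add: inner_L2_def distrib_left mult.left_commute[of "w _"])

lemma inner_grad_eq_sum: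
  assumes "u \<in> H1" "v \<in> H1"
  shows "inner_grad u v = (\<Sum>i\<in>UNIV. inner_L2 (wd i u) (wd i v))"
  unfolding inner_grad_def inner_L2_def
  by (rule Bochner_Integration.integral_sum) (intro integrable_mult_Lp_2 wd_Lp_2 assms)

lemma inner_L2_AE_cong:
  fixes w u v :: "real^'n \<Rightarrow> real"
  assumes "w \<in> borel_measurable borel" "u \<in> borel_measurable borel" "v \<in> borel_measurable borel"
    and ae: "AE x in torus. u x = v x"
  shows "inner_L2 w u = inner_L2 w v"
  unfolding inner_L2_def
  using ae assms(1-3)[THEN borel_measurable_torus] by (intro integral_cong_AE) auto

lemma inner_grad_linear_right:
  assumes "w \<in> H1" "u \<in> H1" "v \<in> H1"
  shows "inner_grad w (\<lambda>x. a * u x + b * v x) = a * inner_grad w u + b * inner_grad w v"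
proof -
  have "inner_L2 (wd i w) (wd i (\<lambda>x. a * u x + b * v x)) = a * inner_L2 (wd i w) (wd i u) + b * inner_L2 (wd i w) (wd i v)" for i
  proof -
    have "inner_L2 (wd i w) (wd i (\<lambda>x. a * u x + b * v x)) = inner_L2 (wd i w) (\<lambda>x. a * wd i u x + b * wd i v x)"
    proof (rule inner_L2_AE_cong)
      show "AE x in torus. wd i (\<lambda>x. a * u x + b * v x) x = a * wd i u x + b * wd i v x"
        by (rule weak_partial_unique[OF weak_partial_wd[OF H1_linear] weak_partial_linear])
          (intro assms weak_partial_wd)+
    qed (use wd_Lp_2[OF assms(1)] wd_Lp_2[OF H1_linear[OF assms(2,3)]]
        Lp_2_linear[OF assms(2,3)[THEN wd_Lp_2]] in \<open>auto simp: Lp_2_iff\<close>)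
    also have "\<dots> = a * inner_L2 (wd i w) (wd i u) + b * inner_L2 (wd i w) (wd i v)"
      by (intro inner_L2_linear_right wd_Lp_2 assms)
    finally show ?thesis .
  qed
  then show ?thesis
    unfolding inner_grad_eq_sum[OF assms(1) H1_linear[OF assms(2,3)]]
      inner_grad_eq_sum[OF assms(1,2)] inner_grad_eq_sum[OF assms(1,3)]
    by (simp add: sum.distrib sum_distrib_left)
qed

lemma bilin_linear_right:
  assumes "w \<in> H1" "u \<in> H1" "v \<in> H1"
  shows "bilin \<nu> \<delta> w (\<lambda>x. a * u x + b * v x) = a * bilin \<nu> \<delta> w u + b * bilin \<nu> \<delta> w v"
proof -
  have "w \<in> Lp 2" "u \<in> Lp 2" "v \<in> Lp 2" using assms H1_iff by auto
  then show ?thesis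
    using assms by (simp add: bilin_def inner_grad_linear_right inner_L2_linear_right algebra_simps)
qed

lemma bilin_sym: "bilin \<nu> \<delta> u v = bilin \<nu> \<delta> v u"
  by (simp add: bilin_def inner_grad_def inner_L2_def mult.commute)

section \<open>Second weak derivatives and Green's formula\<close>

lemma weak_partial_AE_cong:
  fixes u v :: "real^'n \<Rightarrow> real"
  assumes u: "weak_partial i u g" and v: "v \<in> Lp 1" and ae: "AE x in torus. u x = v x"
  shows "weak_partial i v g"
proof -
  have "(\<integral>x. v x * partial i \<phi> x \<partial>torus) = - (\<integral>x. g x * \<phi> x \<partial>torus)" if "test_function \<phi>" for \<phi>
  proof -
    have "inner_L2 (partial i \<phi>) u = inner_L2 (partial i \<phi>) v"
      using u v ae test_function_measurable[OF test_function_partial[OF that]]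
      by (intro inner_L2_AE_cong) (auto simp: weak_partial_def Lp_1_iff)
    moreover have "(\<integral>x. u x * partial i \<phi> x \<partial>torus) = - (\<integral>x. g x * \<phi> x \<partial>torus)"
      using u that unfolding weak_partial_def by blast
    ultimately show ?thesis by (simp add: inner_L2_def mult.commute)
  qed
  then show ?thesis using u v unfolding weak_partial_def by blast
qed

lemma H2_iff: "u \<in> H2 \<longleftrightarrow> u \<in> Lp 2 \<and> (\<forall>i. \<exists>g\<in>H1. weak_partial i u g)"
  by (simp add: numeral_eq_Suc)

lemma H2_imp_H1:
  assumes "u \<in> H2"
  shows "u \<in> H1"
  unfolding H1_iff
proof (intro conjI allI)
  show "u \<in> Lp 2" using assms H2_iff by blast
  fix i
  obtain g where "g \<in> H1" "weak_partial i u g" using assms H2_iff by blast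
  then show "\<exists>g\<in>Lp 2. weak_partial i u g" using H1_iff by blast
qed

text \<open>The chosen \<open>wd i u\<close> may differ from the \<open>H1\<close> witness
  \<open>g\<close> on a null set, so the weak derivatives of \<open>g\<close> have to be transferred
  to it.\<close>

lemma wd_H1:
  assumes u: "u \<in> H2"
  shows "wd i u \<in> H1"
  unfolding H1_iff
proof (intro conjI allI)
  note u1 = H2_imp_H1[OF u]
  show L: "wd i u \<in> Lp 2" by (rule wd_Lp_2[OF u1])
  fix j
  obtain g where g: "g \<in> H1" "weak_partial i u g" using u H2_iff by blast
  then obtain h where h: "h \<in> Lp 2" "weak_partial j g h" using H1_iff by blast
  have "weak_partial j (wd i u) h"
    by (rule weak_partial_AE_cong[OF h(2) Lp_2_subset_1[OF L] weak_partial_unique[OF g(2) weak_partial_wd[OF u1]]])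
  then show "\<exists>g\<in>Lp 2. weak_partial j (wd i u) g" using h by blast
qed

text \<open>Coordinatewise integration by parts with \<open>w = wd i u\<close>, which lies in
  \<open>H1\<close> by \<open>wd_H1\<close>.\<close>

lemma laplacian_integration_by_parts:
  assumes u: "u \<in> H2" and m: "m \<in> H1"
  shows "integrable torus (\<lambda>x. laplacian u x * m x)"
    and "(\<integral>x. laplacian u x * m x \<partial>torus) = - inner_grad u m"
proof -
  have m2: "m \<in> Lp 2" using m H1_iff by blast
  have i: "integrable torus (\<lambda>x. wd i (wd i u) x * m x)" for i
    by (intro integrable_mult_Lp_2 wd_Lp_2 wd_H1 u m2)
  have eq: "laplacian u x * m x = (\<Sum>i\<in>UNIV. wd i (wd i u) x * m x)" for x
    by (simp add: laplacian_def sum_distrib_right)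
  show "integrable torus (\<lambda>x. laplacian u x * m x)"
    unfolding eq by (intro Bochner_Integration.integrable_sum i)
  have "(\<integral>x. laplacian u x * m x \<partial>torus) = (\<Sum>i\<in>UNIV. \<integral>x. wd i (wd i u) x * m x \<partial>torus)"
    unfolding eq by (rule Bochner_Integration.integral_sum) (rule i)
  also have "\<dots> = (\<Sum>i\<in>UNIV. - inner_L2 (wd i u) (wd i m))"
  proof (rule sum.cong[OF refl])
    fix i
    have w: "wd i u \<in> H1" by (rule wd_H1[OF u])
    then have w2: "wd i u \<in> Lp 2" using H1_iff by blast
    show "(\<integral>x. wd i (wd i u) x * m x \<partial>torus) = - inner_L2 (wd i u) (wd i m)"
      using integration_by_parts_Lp_2[OF weak_partial_wd[OF w] w2 wd_Lp_2[OF w]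
          weak_partial_wd[OF m] m2 wd_Lp_2[OF m]]
      by (simp add: inner_L2_def)
  qed
  also have "\<dots> = - inner_grad u m"
    by (simp add: inner_grad_eq_sum[OF H2_imp_H1[OF u] m] sum_negf)
  finally show "(\<integral>x. laplacian u x * m x \<partial>torus) = - inner_grad u m" .
qed

section \<open>Integrability of \<open>f m\<close> against functions in \<open>H1\<close>\<close>

lemma Lp_nat_imp_integrable:
  assumes "u \<in> Lp (of_nat d)" "d > 0"
  shows "u \<in> Lp 1"
proof -
  have "enn2real (of_nat d) = real d" by (metis enn2real_of_nat ennreal_of_nat_eq_real_of_nat of_nat_0_le_iff enn2real_ennreal)
  then have u: "periodic u" "u \<in> borel_measurable borel" "integrable torus (\<lambda>x. \<bar>u x\<bar> powr real d)"
    using assms(1) by (auto simp: Lp_def)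
  have "integrable torus u"
  proof (rule Bochner_Integration.integrable_bound[of torus "\<lambda>x. 1 + \<bar>u x\<bar> powr real d"])
    show "integrable torus (\<lambda>x. 1 + \<bar>u x\<bar> powr real d)" using u(3) by simp
    have "\<bar>t\<bar> \<le> 1 + \<bar>t\<bar> powr real d" for t :: real
    proof (cases "\<bar>t\<bar> \<le> 1")
      case True
      then show ?thesis using powr_ge_zero[of "\<bar>t\<bar>" "real d"] by linarith
    next
      case False
      then have "\<bar>t\<bar> powr 1 \<le> \<bar>t\<bar> powr real d" using assms(2) by (intro powr_mono) auto
      then show ?thesis using False by simp
    qed
    then show "AE x in torus. norm (u x) \<le> norm (1 + \<bar>u x\<bar> powr real d)"
      by (intro AE_I2) (simp add: abs_of_nonneg add_nonneg_nonneg)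
  qed (use u in \<open>auto intro: borel_measurable_torus\<close>)
  then show ?thesis using u by (simp add: Lp_1_iff)
qed

text \<open>The points of a generated topology are those covered by its generators; the zero
  functional with \<open>U = UNIV\<close> covers all of \<open>H1\<close>.\<close>

lemma topspace_weak_H1: "topspace weak_H1_topology = (H1 :: (real^'n \<Rightarrow> real) set)"
proof -
  define z :: "(real^'n \<Rightarrow> real) \<Rightarrow> real" where "z = (\<lambda>u\<in>H1. 0)"
  have "z \<in> dual_H1"
    using H1_linear by (auto simp: dual_H1_def z_def simp del: sobolev.simps One_nat_def intro!: exI[of _ 0])
  then have "{u \<in> H1. z u \<in> UNIV} \<in> {{u \<in> H1. l u \<in> U} | l U. l \<in> dual_H1 \<and> open U}"
    by blast
  then show ?thesis
    unfolding weak_H1_topology_def topology_generated_by_topspace by blast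
qed

text \<open>A continuous map takes values in the points of its target topology, so the continuity
  hypothesis already contains linearity and boundedness of each
  \<open>pairing (f m)\<close>.\<close>

lemma pairing_dual_H1:
  assumes "continuous_map weak_H1_topology dual_H1_topology (\<lambda>m. pairing (f m))" "m \<in> H1"
  shows "pairing (f m) \<in> dual_H1"
  using continuous_map_image_subset_topspace[OF assms(1)] assms(2)
  by (auto simp: topspace_weak_H1 dual_H1_topology_def Metric_space.topspace_mtopology[OF Metric_space_dual_H1]
      simp del: sobolev.simps One_nat_def)

text \<open>
  If \<open>g * m\<close> were not integrable, then neither would be \<open>g * (m + \<phi>)\<close> for any test function \<open>\<phi>\<close>.
  Both integrals then have the junk value 0, so linearity gives \<open>inner_L2 g \<phi> = 0\<close> for every
  \<open>\<phi>\<close>, whence \<open>g = 0\<close>. This replaces the Sobolev embedding that \<open>g \<in> L\<^sup>d\<close> would need for \<open>d = 1\<close>.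
\<close>

lemma integrable_mult_if_dual_H1:
  fixes g m :: "real^'n \<Rightarrow> real"
  assumes g: "g \<in> Lp 1" and dual: "pairing g \<in> dual_H1" and m: "m \<in> H1"
  shows "integrable torus (\<lambda>x. g x * m x)"
proof (rule ccontr)
  assume not: "\<not> integrable torus (\<lambda>x. g x * m x)"
  have "AE x in torus. g x = 0"
  proof (rule fundamental_lemma[OF g])
    fix \<phi> :: "real^'n \<Rightarrow> real" assume \<phi>: "test_function \<phi>"
    have \<phi>1: "\<phi> \<in> H1" by (rule test_function_H1[OF \<phi>])
    have i: "integrable torus (\<lambda>x. g x * \<phi> x)"
      using g \<phi> by (auto simp: Lp_1_iff intro: integrable_mult_test_function)
    have "\<not> integrable torus (\<lambda>x. g x * (1 * m x + 1 * \<phi> x))"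
    proof
      assume "integrable torus (\<lambda>x. g x * (1 * m x + 1 * \<phi> x))"
      from Bochner_Integration.integrable_diff[OF this i] not show False by (simp add: algebra_simps)
    qed
    then have 0: "inner_L2 g (\<lambda>x. 1 * m x + 1 * \<phi> x) = 0" "inner_L2 g m = 0"
      using not by (simp_all add: inner_L2_def not_integrable_integral_eq)
    have "pairing g (\<lambda>x. 1 * m x + 1 * \<phi> x) = 1 * pairing g m + 1 * pairing g \<phi>"
      using dual m \<phi>1 unfolding dual_H1_def by blast
    then show "(\<integral>x. g x * \<phi> x \<partial>torus) = 0"
      using 0 H1_linear[OF m \<phi>1, of 1 1] m \<phi>1
      by (simp add: pairing_def inner_L2_def del: sobolev.simps One_nat_def)
  qed
  then have "integrable torus (\<lambda>x. g x * m x) \<longleftrightarrow> integrable torus (\<lambda>x::real^'n. 0 :: real)"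
    using g m unfolding H1_iff
    by (intro integrable_cong_AE) (auto simp: Lp_1_iff Lp_2_iff intro!: borel_measurable_times borel_measurable_torus)
  then show False using not by simp
qed

section \<open>The variational characterization\<close>

text \<open>Convexity bounds the difference quotient by \<open>F m' - F m\<close> for 0 < \<theta> <
  1, and the bound passes to the limit from the right.\<close>

lemma convex_gradient_inequality:
  fixes F :: "(real^'n \<Rightarrow> real) \<Rightarrow> real"
  assumes convex: "\<And>\<theta>. 0 < \<theta> \<Longrightarrow> \<theta> < 1 \<Longrightarrow> F (\<lambda>x. (1 - \<theta>) * m x + \<theta> * m' x) \<le> (1 - \<theta>) * F m + \<theta> * F m'"
    and deriv: "((\<lambda>\<theta>. (F (\<lambda>x. (1 - \<theta>) * m x + \<theta> * m' x) - F m) / \<theta>) \<longlongrightarrow> D) (at 0)"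
  shows "F m + D \<le> F m'"
proof -
  have "D \<le> F m' - F m"
  proof (rule tendsto_upperbound)
    show "((\<lambda>\<theta>. (F (\<lambda>x. (1 - \<theta>) * m x + \<theta> * m' x) - F m) / \<theta>) \<longlongrightarrow> D) (at_right 0)"
      using deriv by (rule tendsto_within_subset) auto
    have "(F (\<lambda>x. (1 - \<theta>) * m x + \<theta> * m' x) - F m) / \<theta> \<le> F m' - F m" if "0 < \<theta>" "\<theta> < 1" for \<theta>
      using convex[OF that] that by (simp add: field_simps)
    then show "\<forall>\<^sub>F \<theta> in at_right 0. (F (\<lambda>x. (1 - \<theta>) * m x + \<theta> * m' x) - F m) / \<theta> \<le> F m' - F m"
      by (intro eventually_at_rightI[of 0 1]) auto
  qed simp
  then show ?thesis by simp
qed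

text \<open>The obstacle \<open>M u\<close> stays fixed while the competitor varies, so lowering
  \<open>u\<close> by a nonnegative \<phi> keeps it admissible.\<close>

lemma QVI_subsolution:
  assumes u: "u \<in> H1" and QVI: "obstacle_QVI \<nu> \<delta> K k g u" and \<phi>: "\<phi> \<in> H1" "ae_le (\<lambda>x. 0) \<phi>"
  shows "bilin \<nu> \<delta> u \<phi> \<le> inner_L2 g \<phi>"
proof -
  have v: "(\<lambda>x. u x - \<phi> x) \<in> H1" using H1_linear[OF u \<phi>(1), of 1 "-1"] by simp
  have "AE x in torus. u x \<le> jump_op K k u x" "AE x in torus. 0 \<le> \<phi> x"
    using QVI \<phi>(2) by (auto simp: obstacle_QVI_def ae_le_def)
  then have "ae_le (\<lambda>x. u x - \<phi> x) (jump_op K k u)"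
    unfolding ae_le_def by eventually_elim simp
  then have "bilin \<nu> \<delta> u (\<lambda>x. u x - \<phi> x - u x) \<ge> inner_L2 g (\<lambda>x. u x - \<phi> x - u x)"
    using QVI v unfolding obstacle_QVI_def by blast
  moreover have "bilin \<nu> \<delta> u (\<lambda>x. u x - \<phi> x - u x) = - bilin \<nu> \<delta> u \<phi>"
    using bilin_linear_right[OF u u \<phi>(1), of \<nu> \<delta> 0 "-1"] by simp
  \<comment> \<open>Valid for every \<open>g\<close>: if the product is not integrable, both sides
    are 0.\<close>
  moreover have "inner_L2 g (\<lambda>x. u x - \<phi> x - u x) = - inner_L2 g \<phi>"
    by (simp add: inner_L2_def)
  ultimately show ?thesis by simp
qed

theorem theorem2p5:
  fixes \<nu> \<delta> C :: real
    and \<rho> u m :: "real^'n \<Rightarrow> real"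
    and K :: "(real^'n) set"
    and k :: "real^'n \<Rightarrow> real^'n \<Rightarrow> real"
    and F :: "(real^'n \<Rightarrow> real) \<Rightarrow> real"
    and f :: "(real^'n \<Rightarrow> real) \<Rightarrow> real^'n \<Rightarrow> real"
  assumes "\<nu> > 0" and "\<delta> > 0"
    and "\<rho> \<in> Lp 2" and "ae_le (\<lambda>x. 0) \<rho>"
    and "finite K" and "K \<noteq> {}" and "K \<subseteq> unit_cell"
    and "smooth_cost K k"
    and F_classes: "\<And>m m'. m \<in> H1 \<Longrightarrow> m' \<in> H1 \<Longrightarrow> ae_eq m m' \<Longrightarrow> F m = F m'"
    and F_strictly_convex: "\<And>m m' \<theta>. m \<in> H1 \<Longrightarrow> m' \<in> H1 \<Longrightarrow> \<not> ae_eq m m' \<Longrightarrow> 0 < \<theta> \<Longrightarrow> \<theta> < 1 \<Longrightarrow>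
        F (\<lambda>x. (1 - \<theta>) * m x + \<theta> * m' x) < (1 - \<theta>) * F m + \<theta> * F m'"
    and F_bounded_below: "\<exists>B. \<forall>m\<in>H1. B \<le> F m"
    and f_classes: "\<And>m m'. m \<in> H1 \<Longrightarrow> m' \<in> H1 \<Longrightarrow> ae_eq m m' \<Longrightarrow> ae_eq (f m) (f m')"
    and F_derivative: "\<And>m m'. m \<in> H1 \<Longrightarrow> m' \<in> H1 \<Longrightarrow>
        ((\<lambda>\<theta>. (F (\<lambda>x. (1 - \<theta>) * m x + \<theta> * m' x) - F m) / \<theta>)
          \<longlongrightarrow> integral\<^sup>L torus (\<lambda>x. f m x * (m' x - m x))) (at 0)"
    and f_continuous: "continuous_map weak_H1_topology dual_H1_topology (\<lambda>m. pairing (f m))"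
    and "C > 0"
    and f_bounded_below: "\<And>m. m \<in> H1 \<Longrightarrow> ae_le (\<lambda>x. 0) m \<Longrightarrow> ae_le (\<lambda>x. - C) (f m)"
    and f_bounded_range: "\<exists>R. \<forall>m\<in>H1. f m \<in> Lp (of_nat CARD('n)) \<and> Lp_norm (of_nat CARD('n)) (f m) \<le> R"
    and solution: "MFG_solution \<nu> \<delta> \<rho> K k f u m"
  shows "is_arg_min (\<lambda>m'. ereal (F m') - dual_value \<nu> \<delta> \<rho> K k m') (\<lambda>m'. m' \<in> H1 \<and> ae_le (\<lambda>x. 0) m') m \<and>
    (\<forall>m0. is_arg_min (\<lambda>m'. ereal (F m') - dual_value \<nu> \<delta> \<rho> K k m') (\<lambda>m'. m' \<in> H1 \<and> ae_le (\<lambda>x. 0) m') m0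
       \<longrightarrow> ae_eq m0 m)"
proof -
  have QVI: "obstacle_QVI \<nu> \<delta> K k (f m) u" and u2: "u \<in> H2" and m: "m \<in> H1" "ae_le (\<lambda>x. 0) m"
    and VI: "\<And>v. v \<in> H1 \<Longrightarrow> ae_le v (jump_op K k v) \<Longrightarrow>
        bilin \<nu> \<delta> m (\<lambda>x. v x - u x) \<ge> inner_L2 \<rho> (\<lambda>x. v x - u x)"
    and compl: "(\<integral>x. (- \<nu> * laplacian u x + \<delta> * u x - f m x) * m x \<partial>torus) = 0"
    using solution unfolding MFG_solution_def by blast+
  have u: "u \<in> H1" by (rule H2_imp_H1[OF u2])
  have L2: "u \<in> Lp 2" "m \<in> Lp 2" using u m(1) H1_iff by blast+
  have uM: "ae_le u (jump_op K k u)" using QVI by (simp add: obstacle_QVI_def)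
  have fL1: "f m \<in> Lp 1"
    using f_bounded_range m(1) by (intro Lp_nat_imp_integrable[of _ "CARD('n)"]) auto
  have dual: "pairing (f m) \<in> dual_H1" by (rule pairing_dual_H1[OF f_continuous m(1)])
  have fm: "integrable torus (\<lambda>x. f m x * m x)"
    by (rule integrable_mult_if_dual_H1[OF fL1 dual m(1)])
  \<comment> \<open>The integral in the third equation may be split because each of the three
    products with \<open>m\<close> is integrable; for \<open>f m\<close> this is
    \<open>fm\<close>.\<close>
  have energy: "bilin \<nu> \<delta> u m = inner_L2 (f m) m"
  proof -
    note ibp = laplacian_integration_by_parts[OF u2 m(1)]
    have um: "integrable torus (\<lambda>x. u x * m x)" by (rule integrable_mult_Lp_2[OF L2])
    have "(- \<nu> * laplacian u x + \<delta> * u x - f m x) * m x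
        = - \<nu> * (laplacian u x * m x) + \<delta> * (u x * m x) - f m x * m x" for x
      by (simp add: algebra_simps)
    then have "- \<nu> * (\<integral>x. laplacian u x * m x \<partial>torus) + \<delta> * inner_L2 u m - inner_L2 (f m) m = 0"
      using compl ibp(1) um fm by (simp add: inner_L2_def)
    then show ?thesis by (simp add: ibp(2) bilin_def)
  qed
  let ?J = "\<lambda>m'. ereal (F m') - dual_value \<nu> \<delta> \<rho> K k m'"
  \<comment> \<open>The function \<open>u\<close> is admissible because \<open>u \<le> M u\<close>,
    so the second condition says that the infimum is attained there. In particular
    \<open>D(m)\<close> is finite.\<close>
  have Dm: "dual_value \<nu> \<delta> \<rho> K k m = ereal (bilin \<nu> \<delta> m u - inner_L2 \<rho> u)"
    unfolding dual_value_def
  proof (rule INF_eqI)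
    fix v assume "v \<in> {v \<in> H1. ae_le v (jump_op K k v)}"
    then have v: "v \<in> H1" "ae_le v (jump_op K k v)" by auto
    have v2: "v \<in> Lp 2" using v(1) H1_iff by blast
    have "bilin \<nu> \<delta> m (\<lambda>x. v x - u x) = bilin \<nu> \<delta> m v - bilin \<nu> \<delta> m u"
      using bilin_linear_right[OF m(1) v(1) u, of \<nu> \<delta> 1 "-1"] by simp
    moreover have "inner_L2 \<rho> (\<lambda>x. v x - u x) = inner_L2 \<rho> v - inner_L2 \<rho> u"
      using inner_L2_linear_right[OF \<open>\<rho> \<in> Lp 2\<close> v2 L2(1), of 1 "-1"] by simp
    ultimately show "ereal (bilin \<nu> \<delta> m u - inner_L2 \<rho> u) \<le> ereal (bilin \<nu> \<delta> m v - inner_L2 \<rho> v)"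
      using VI[OF v] by simp
  next
    fix y assume "\<And>v. v \<in> {v \<in> H1. ae_le v (jump_op K k v)} \<Longrightarrow> y \<le> ereal (bilin \<nu> \<delta> m v - inner_L2 \<rho> v)"
    then show "y \<le> ereal (bilin \<nu> \<delta> m u - inner_L2 \<rho> u)" using u uM by blast
  qed
  \<comment> \<open>Strict convexity speaks only of functions that differ on a set of positive
    measure; the remaining case follows from invariance of \<open>F\<close> under almost everywhere
    equality.\<close>
  have convex: "F (\<lambda>x. (1 - \<theta>) * m x + \<theta> * m' x) \<le> (1 - \<theta>) * F m + \<theta> * F m'"
    if m': "m' \<in> H1" and \<theta>: "0 < \<theta>" "\<theta> < 1" for m' \<theta>
  proof (cases "ae_eq m m'")
    case True
    have "AE x in torus. m x = (1 - \<theta>) * m x + \<theta> * m' x"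
      using True unfolding ae_eq_def by eventually_elim (simp add: algebra_simps)
    then have "F m = F (\<lambda>x. (1 - \<theta>) * m x + \<theta> * m' x)"
      by (intro F_classes m(1) H1_linear m') (simp add: ae_eq_def)
    moreover have "F m = F m'" by (rule F_classes[OF m(1) m' True])
    ultimately show ?thesis by (simp add: algebra_simps)
  next
    case False
    then show ?thesis using F_strictly_convex[OF m(1) m' False \<theta>] by simp
  qed
  have pair_diff: "(\<integral>x. f m x * (m' x - m x) \<partial>torus) = inner_L2 (f m) m' - inner_L2 (f m) m"
    if m': "m' \<in> H1" for m'
  proof -
    have "(\<integral>x. f m x * m' x - f m x * m x \<partial>torus) = inner_L2 (f m) m' - inner_L2 (f m) m"
      unfolding inner_L2_def
      by (rule Bochner_Integration.integral_diff[OF integrable_mult_if_dual_H1[OF fL1 dual m'] fm])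
    then show ?thesis by (simp add: right_diff_distrib)
  qed
  have gradient: "F m + (inner_L2 (f m) m' - inner_L2 (f m) m) \<le> F m'" if m': "m' \<in> H1" for m'
    using convex_gradient_inequality[OF convex[OF m'] F_derivative[OF m(1) m']] pair_diff[OF m'] by simp
  have gradient_strict: "F m + (inner_L2 (f m) m' - inner_L2 (f m) m) < F m'"
    if m': "m' \<in> H1" and ne: "\<not> ae_eq m m'" for m'
  proof -
    \<comment> \<open>The midpoint: \<open>gradient\<close> at \<open>h\<close> and strict convexity
      bound \<open>F h\<close> from below and strictly from above, and doubling the outcome gives
      the strict inequality at \<open>m'\<close>.\<close>
    define h where "h = (\<lambda>x. (1 - 1/2) * m x + 1/2 * m' x)"
    have h: "h \<in> H1" unfolding h_def by (rule H1_linear[OF m(1) m'])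
    have "inner_L2 (f m) h = (1 - 1/2) * inner_L2 (f m) m + 1/2 * inner_L2 (f m) m'"
    proof -
      have "f m x * h x = (1 - 1/2) * (f m x * m x) + 1/2 * (f m x * m' x)" for x
        by (simp add: h_def algebra_simps)
      then show ?thesis
        using fm integrable_mult_if_dual_H1[OF fL1 dual m'] by (simp add: inner_L2_def)
    qed
    moreover have "F h < (1 - 1/2) * F m + 1/2 * F m'"
      unfolding h_def by (rule F_strictly_convex[OF m(1) m' ne]) auto
    ultimately show ?thesis using gradient[OF h] by simp
  qed
  \<comment> \<open>Both dual values are compared through \<open>u\<close>, and the terms with
    \<rho> cancel. Adding a real number to \<open>?J m'\<close>, instead of subtracting two extended
    reals, keeps the statement meaningful when \<open>D(m')\<close> is -\<infinity>.\<close>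
  have lower: "?J m \<le> ereal (F m + (inner_L2 (f m) m' - inner_L2 (f m) m) - F m') + ?J m'"
    if m': "m' \<in> H1" "ae_le (\<lambda>x. 0) m'" for m'
  proof -
    have sub: "bilin \<nu> \<delta> m' u \<le> inner_L2 (f m) m'"
      using QVI_subsolution[OF u QVI m'] by (simp add: bilin_sym)
    have "dual_value \<nu> \<delta> \<rho> K k m' \<le> ereal (bilin \<nu> \<delta> m' u - inner_L2 \<rho> u)"
      unfolding dual_value_def by (rule INF_lower) (use u uM in blast)
    moreover have "bilin \<nu> \<delta> m u = inner_L2 (f m) m" using energy by (simp add: bilin_sym)
    ultimately show ?thesis
      unfolding Dm using sub by (cases "dual_value \<nu> \<delta> \<rho> K k m'") auto
  qed
  have min: "?J m \<le> ?J m'" if m': "m' \<in> H1" "ae_le (\<lambda>x. 0) m'" for m'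
    using lower[OF m'] gradient[OF m'(1)] by (cases "?J m'"; cases "?J m") auto
  have uniq: "?J m < ?J m'" if m': "m' \<in> H1" "ae_le (\<lambda>x. 0) m'" and ne: "\<not> ae_eq m' m" for m'
  proof -
    have ne': "\<not> ae_eq m m'" using ne by (simp add: ae_eq_def eq_commute)
    show ?thesis
      \<comment> \<open>Here \<open>Dm\<close> enters through the finiteness of \<open>?J m\<close>:
        adding a negative real makes a strict difference only for finite values.\<close>
      using lower[OF m'] gradient_strict[OF m'(1) ne'] Dm by (cases "?J m'"; cases "?J m") auto
  qed
  show ?thesis
    unfolding is_arg_min_def using m min uniq by (meson leD)
qed

end
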